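(* For $(j,k)=(0,1)$, $(0,3)$ or $(1,3)$, \[ L_{U}(a,\lambda) =-U'(a,0) U_{0}^{(j,k)}(-a,2\lambda)-\tfrac{1}{2}U(a,0) U_{1}^{(j,k)}(-a,2\lambda). \]
   Context: $U(a,z)$ is the standard parabolic cylinder function, the solution of $y''-(\tfrac14 z^2+a)y=0$ with $U(a,z)\sim z^{-a-1/2}e^{-z^2/4}$ as $z\to\infty$, $|\arg z|\le\tfrac34\pi-\delta$. $L_{U}(a,\lambda)=\int_{0}^{\infty} e^{-\lambda t} U(a,t)dt$ (entire in $\lambda$). For $R=0,1$: $U_{R}^{(1,3)}(a,z)=\frac{i\Gamma(\tfrac{1}{2}-a)}{\sqrt{2\pi}}[U(-a,iz)\int_{i\infty}^z t^{R}U(-a,-it)dt-U(-a,-iz) \int_{-i\infty}^z t^{R}U(-a,it)dt]$; $U_{R}^{(0,1)}(a,z)=e^{(\frac{1}{2}a-\frac{1}{4})\pi i}[U(-a,-iz) \int_{\infty}^z t^{R}U(a,t)dt-U(a,z) \int_{i\infty}^z t^{R}U(-a,-it)dt]$; and $U_{R}^{(0,3)}(a,z)$ is given by the formula for $U_{R}^{(0,1)}$ with $i$ replaced by $-i$. These solve $y''-(\tfrac14 z^2+a)y=z^R$. *)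

theory Defs
  imports "HOL-Analysis.Analysis"
begin

definition pc_sector :: "real \<Rightarrow> complex set" where
  "pc_sector \<delta> = {z. \<bar>Arg z\<bar> \<le> 3 * pi / 4 - \<delta>}"

text \<open>Characterising properties of the standard parabolic cylinder function U(a,.):
  an entire solution of  y'' - (z^2/4 + a) y = 0  with
  y(z) ~ z^(-a-1/2) e^(-z^2/4) as z -> infinity in |arg z| <= 3pi/4 - delta (every delta > 0).\<close>
definition is_pcU :: "complex \<Rightarrow> (complex \<Rightarrow> complex) \<Rightarrow> bool" where
  "is_pcU a f \<longleftrightarrow>
     f holomorphic_on UNIV \<and>
     (\<forall>z. deriv (deriv f) z = (z\<^sup>2 / 4 + a) * f z) \<and>
     (\<forall>\<delta>>0. filterlim (\<lambda>z. f z / (z powr (- a - 1/2) * exp (- z\<^sup>2 / 4)))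
                (nhds 1) (inf at_infinity (principal (pc_sector \<delta>))))"

definition pcU :: "complex \<Rightarrow> complex \<Rightarrow> complex" where
  "pcU a = (THE f. is_pcU a f)"

definition LU :: "complex \<Rightarrow> complex \<Rightarrow> complex" where
  "LU a lam = integral {0..} (\<lambda>t::real. exp (- lam * of_real t) * pcU a (of_real t))"

text \<open>Integral from the point at infinity in direction d (a unit complex number) to z,
  taken along the ray  z + s d, s >= 0:  int_{d infty}^z g(t) dt = - int_0^infty g(z + s d) d ds.\<close>
definition int_from_inf :: "complex \<Rightarrow> (complex \<Rightarrow> complex) \<Rightarrow> complex \<Rightarrow> complex" where
  "int_from_inf d g z = - integral {0..} (\<lambda>s::real. g (z + of_real s * d) * d)"

definition U13 :: "nat \<Rightarrow> complex \<Rightarrow> complex \<Rightarrow> complex" where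
  "U13 R a z = \<i> * Gamma (1/2 - a) / sqrt (2 * pi) *
     (pcU (-a) (\<i> * z) * int_from_inf \<i> (\<lambda>t. t ^ R * pcU (-a) (- \<i> * t)) z
      - pcU (-a) (- \<i> * z) * int_from_inf (- \<i>) (\<lambda>t. t ^ R * pcU (-a) (\<i> * t)) z)"

definition U01 :: "nat \<Rightarrow> complex \<Rightarrow> complex \<Rightarrow> complex" where
  "U01 R a z = exp ((a / 2 - 1/4) * pi * \<i>) *
     (pcU (-a) (- \<i> * z) * int_from_inf 1 (\<lambda>t. t ^ R * pcU a t) z
      - pcU a z * int_from_inf \<i> (\<lambda>t. t ^ R * pcU (-a) (- \<i> * t)) z)"

definition U03 :: "nat \<Rightarrow> complex \<Rightarrow> complex \<Rightarrow> complex" where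
  "U03 R a z = exp (- (a / 2 - 1/4) * pi * \<i>) *
     (pcU (-a) (\<i> * z) * int_from_inf 1 (\<lambda>t. t ^ R * pcU a t) z
      - pcU a z * int_from_inf (- \<i>) (\<lambda>t. t ^ R * pcU (-a) (\<i> * t)) z)"

end

theory Submission
  imports Defs "HOL-Complex_Analysis.Complex_Analysis" "HOL-Real_Asymp.Real_Asymp"
begin

text \<open>Integrating by parts, \<open>y(z) = LU a (z/2)\<close> solves the inhomogeneous equation
  \<open>y'' - (z\<^sup>2/4 - a) y = - U'(a,0) - U(a,0) z / 2\<close>, and it is bounded on the rays considered.
  If \<open>u\<close> is a homogeneous solution that is recessive in the direction \<open>d\<close>, then integrating
  \<open>(y u' - y' u)'\<close> along the ray from \<open>z\<close> in the direction \<open>d\<close> expresses \<open>y u' - y' u\<close> through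
  \<open>\<integral> t^R u(t) dt\<close>. Two such solutions give a linear system for \<open>y\<close> and \<open>y'\<close> whose determinant is
  their Wronskian. The Wronskian of \<open>U(A,z)\<close> and \<open>U(-A,\<mp>iz)\<close> is read off the asymptotics on the ray
  \<open>arg z = \<plusminus>\<pi>/4\<close>, where both are oscillatory; that of \<open>U(a,-iz)\<close> and \<open>U(a,iz)\<close> from the values at \<open>0\<close>.

  Existence of \<open>U(a,\<sqdot>)\<close> for \<open>Re a > 1/2\<close> comes from the Laplace integral
  \<open>e^(-z\<^sup>2/4) / \<Gamma>(a+1/2) \<integral> t^(a-1/2) e^(-t\<^sup>2/2-zt) dt\<close> along rays \<open>arg t = -\<theta>\<close> with
  \<open>\<bar>\<theta>\<bar> < \<pi>/4\<close>. All these integrals agree, because they solve the same equation and have the same recessive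
  behaviour on the positive real axis; together they cover the sector \<open>\<bar>arg z\<bar> < 3\<pi>/4\<close>. The three-term recurrence
  in \<open>a\<close> then reaches all other parameters.\<close>

section \<open>Exponentially decaying functions on the half-line\<close>

text \<open>The rate \<open>k\<close> may have either sign. Negative rates admit powers and
  polynomials into the same calculus: rates add under products, and a positive total rate gives
  absolute integrability.\<close>

definition exp_decay :: "real \<Rightarrow> (real \<Rightarrow> complex) \<Rightarrow> bool" where
  "exp_decay k g \<longleftrightarrow> continuous_on {0..} g \<and> (\<exists>C. \<forall>s\<ge>0. norm (g s) \<le> C * exp (- (k * s)))"

lemma exp_decayI:
  assumes "continuous_on {0..} g" "\<And>s. s \<ge> 0 \<Longrightarrow> norm (g s) \<le> C * exp (- (k * s))"
  shows "exp_decay k g"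
  using assms unfolding exp_decay_def by blast

lemma exp_decayE:
  assumes "exp_decay k g"
  obtains C where "C > 0" "\<And>s. s \<ge> 0 \<Longrightarrow> norm (g s) \<le> C * exp (- (k * s))"
proof -
  from assms obtain C where C: "\<forall>s\<ge>0. norm (g s) \<le> C * exp (- (k * s))"
    unfolding exp_decay_def by blast
  have "norm (g s) \<le> (\<bar>C\<bar> + 1) * exp (- (k * s))" if "s \<ge> 0" for s
    using C that by (smt (verit, best) exp_gt_zero mult_right_mono)
  moreover have "\<bar>C\<bar> + 1 > 0" by simp
  ultimately show ?thesis using that by blast
qed

lemma exp_decay_continuous: "exp_decay k g \<Longrightarrow> continuous_on {0..} g"
  by (simp add: exp_decay_def)

lemma exp_decay_mono:
  assumes "exp_decay k g" "l \<le> k" shows "exp_decay l g"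
proof -
  obtain C where C: "C > 0" "\<And>s. s \<ge> 0 \<Longrightarrow> norm (g s) \<le> C * exp (- (k * s))"
    using exp_decayE[OF assms(1)] by blast
  show ?thesis
  proof (rule exp_decayI[OF exp_decay_continuous[OF assms(1)]])
    fix s :: real assume s: "s \<ge> 0"
    have "exp (- (k * s)) \<le> exp (- (l * s))" using s assms(2) by (simp add: mult_right_mono)
    thus "norm (g s) \<le> C * exp (- (l * s))" using C s by (smt (verit) mult_left_mono)
  qed
qed

lemma exp_decay_add:
  assumes "exp_decay k f" "exp_decay k g" shows "exp_decay k (\<lambda>s. f s + g s)"
proof -
  obtain C where C: "C > 0" "\<And>s. s \<ge> 0 \<Longrightarrow> norm (f s) \<le> C * exp (- (k * s))"
    using exp_decayE[OF assms(1)] by blast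
  obtain D where D: "D > 0" "\<And>s. s \<ge> 0 \<Longrightarrow> norm (g s) \<le> D * exp (- (k * s))"
    using exp_decayE[OF assms(2)] by blast
  show ?thesis
    by (rule exp_decayI[where C = "C + D"])
       (auto intro!: continuous_intros exp_decay_continuous[OF assms(1)] exp_decay_continuous[OF assms(2)]
           norm_triangle_le add_mono C D simp: distrib_right)
qed

lemma exp_decay_mult:
  assumes "exp_decay k f" "exp_decay l g" shows "exp_decay (k + l) (\<lambda>s. f s * g s)"
proof -
  obtain C where C: "C > 0" "\<And>s. s \<ge> 0 \<Longrightarrow> norm (f s) \<le> C * exp (- (k * s))"
    using exp_decayE[OF assms(1)] by blast
  obtain D where D: "D > 0" "\<And>s. s \<ge> 0 \<Longrightarrow> norm (g s) \<le> D * exp (- (l * s))"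
    using exp_decayE[OF assms(2)] by blast
  show ?thesis
  proof (rule exp_decayI[where C = "C * D"])
    show "continuous_on {0..} (\<lambda>s. f s * g s)"
      by (intro continuous_intros exp_decay_continuous[OF assms(1)] exp_decay_continuous[OF assms(2)])
    fix s :: real assume s: "s \<ge> 0"
    have "norm (f s * g s) \<le> (C * exp (- (k * s))) * (D * exp (- (l * s)))"
      unfolding norm_mult using C D s by (intro mult_mono) auto
    also have "\<dots> = C * D * exp (- ((k + l) * s))"
      by (simp add: algebra_simps flip: exp_add)
    finally show "norm (f s * g s) \<le> C * D * exp (- ((k + l) * s))" .
  qed
qed

lemma exp_decay_const: "exp_decay 0 (\<lambda>s. c)"
  by (rule exp_decayI[where C = "norm c"]) auto

lemma exp_decay_cmult: "exp_decay k f \<Longrightarrow> exp_decay k (\<lambda>s. c * f s)"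
  using exp_decay_mult[OF exp_decay_const, of k f c] by simp

lemma exp_decay_diff:
  assumes "exp_decay k f" "exp_decay k g" shows "exp_decay k (\<lambda>s. f s - g s)"
  using exp_decay_add[OF assms(1) exp_decay_cmult[OF assms(2), of "-1"]] by simp

lemma exp_decay_exp: "exp_decay (Re p) (\<lambda>s. exp (- (p * of_real s)))"
  by (rule exp_decayI[where C = 1]) (auto intro!: continuous_intros)

text \<open>This is \<open>e * s\<close> \<le> \<open>exp (e * s)\<close> raised to the power
  \<open>r\<close>. The free parameter \<open>e\<close> tunes the exponential rate.\<close>

lemma powr_le_exp:
  fixes r e s :: real
  assumes "r \<ge> 0" "e > 0" "s \<ge> 0"
  shows "s powr r \<le> (1 / e) powr r * exp (r * e * s)"
proof -
  have "e * s \<le> exp (e * s)" using exp_ge_add_one_self[of "e * s"] by linarith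
  hence "s \<le> 1 / e * exp (e * s)" using assms by (simp add: field_simps)
  hence "s powr r \<le> (1 / e * exp (e * s)) powr r" using assms by (intro powr_mono2) auto
  also have "\<dots> = (1 / e) powr r * exp (r * e * s)"
    using assms by (subst powr_mult) (simp_all add: exp_powr_real mult.commute mult.left_commute)
  finally show ?thesis .
qed

lemma exp_decay_powr:
  assumes "Re b > 0" "k < 0" shows "exp_decay k (\<lambda>s. of_real s powr b)"
\<comment> \<open>The constant is that of \<open>powr_le_exp\<close> with
  \<open>e = - k / Re b\<close>, chosen so that the exponent \<open>r * e\<close> is exactly
  \<open>- k\<close>.\<close>
proof (rule exp_decayI[where C = "(1 / (- k / Re b)) powr Re b"])
  show "continuous_on {0..} (\<lambda>s. of_real s powr b :: complex)"
    using assms by (intro continuous_intros) auto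
  fix s :: real assume s: "s \<ge> 0"
  have "norm (of_real s powr b :: complex) = s powr Re b"
    using s by (simp add: norm_powr_real_powr)
  also have "\<dots> \<le> (1 / (- k / Re b)) powr Re b * exp (Re b * (- k / Re b) * s)"
    using assms s by (intro powr_le_exp) (auto simp: divide_neg_pos)
  also have "Re b * (- k / Re b) * s = - (k * s)" using assms by simp
  finally show "norm (of_real s powr b :: complex) \<le> (1 / (- k / Re b)) powr Re b * exp (- (k * s))" .
qed

lemma exp_decay_of_real:
  assumes "k < 0" shows "exp_decay k (\<lambda>s. of_real s)"
proof -
  have "exp_decay k (\<lambda>s. of_real s powr 1)" using assms by (intro exp_decay_powr) auto
  thus ?thesis by simp
qed

text \<open>A factor \<open>s\<close> is absorbed at the price of an arbitrarily small loss
  \<open>k - l\<close> of rate.\<close>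

lemma exp_decay_of_real_mult:
  assumes "exp_decay k g" "l < k" shows "exp_decay l (\<lambda>s. of_real s * g s)"
  using exp_decay_mult[OF exp_decay_of_real[of "l - k"] assms(1)] assms(2) by simp

lemma exp_decay_absolutely_integrable:
  assumes "exp_decay k g" "k > 0" shows "g absolutely_integrable_on {0..}"
proof -
  obtain C where C: "C > 0" "\<And>s. s \<ge> 0 \<Longrightarrow> norm (g s) \<le> C * exp (- (k * s))"
    using exp_decayE[OF assms(1)] by blast
  show ?thesis
  proof (rule measurable_bounded_by_integrable_imp_absolutely_integrable)
    show "g \<in> borel_measurable (lebesgue_on {0..})"
      by (rule continuous_imp_measurable_on_sets_lebesgue[OF exp_decay_continuous[OF assms(1)]]) auto
    show "(\<lambda>s. C * exp (- (k * s))) integrable_on {0..}"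
      using integrable_on_exp_minus_to_infinity[OF assms(2), of 0]
      by (intro integrable_on_mult_right) simp
  qed (use C in auto)
qed

lemma exp_decay_integrable:
  assumes "exp_decay k g" "k > 0" shows "g integrable_on {0..}"
  using exp_decay_absolutely_integrable[OF assms] by (rule set_lebesgue_integral_eq_integral(1))

lemma exp_decay_tendsto_0:
  assumes "exp_decay k g" "k > 0" shows "(g \<longlongrightarrow> 0) at_top"
proof -
  obtain C where C: "C > 0" "\<And>s. s \<ge> 0 \<Longrightarrow> norm (g s) \<le> C * exp (- (k * s))"
    using exp_decayE[OF assms(1)] by blast
  have "((\<lambda>s. C * exp (- (k * s))) \<longlongrightarrow> 0) at_top" using assms(2) by real_asymp
  moreover have "eventually (\<lambda>s. norm (g s) \<le> C * exp (- (k * s))) at_top"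
    using C(2) by (intro eventually_at_top_linorderI[of 0])
  ultimately show ?thesis by (rule Lim_null_comparison[rotated])
qed

section \<open>Improper integrals and differentiation of Laplace transforms\<close>

lemma tendsto_integral_Ici:
  fixes f :: "real \<Rightarrow> complex"
  assumes "f absolutely_integrable_on {a..}"
  shows "((\<lambda>b. integral {a..b} f) \<longlongrightarrow> integral {a..} f) at_top"
proof -
  have "((\<lambda>b. set_lebesgue_integral lebesgue {a..b} f) \<longlongrightarrow> set_lebesgue_integral lebesgue {a..} f) at_top"
    using assms by (intro tendsto_set_lebesgue_integral_at_top) auto
  moreover have "set_lebesgue_integral lebesgue {a..b} f = integral {a..b} f" for b
    using assms by (intro set_lebesgue_integral_eq_integral set_integrable_subset[OF assms]) auto
  ultimately show ?thesis using set_lebesgue_integral_eq_integral(2)[OF assms] by simp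
qed

text \<open>The derivative is demanded only for \<open>s > 0\<close>, because one application has
  the factor \<open>s powr (b + 1)\<close>, which is handled at 0 by continuity alone. Since
  \<open>F\<close> vanishes at infinity, only the boundary value at 0 survives.\<close>

lemma integral_Ici_FTC:
  fixes F f :: "real \<Rightarrow> complex"
  assumes cont: "continuous_on {0..} F"
    and der: "\<And>s. s > 0 \<Longrightarrow> (F has_vector_derivative f s) (at s)"
    and int: "f absolutely_integrable_on {0..}"
    and lim: "(F \<longlongrightarrow> 0) at_top"
  shows "integral {0..} f = - F 0"
proof -
  have "integral {0..b} f = F b - F 0" if "b \<ge> 0" for b
    using fundamental_theorem_of_calculus_interior[OF that, of F f] der
      continuous_on_subset[OF cont, of "{0..b}"] by (auto intro: integral_unique)
  hence "eventually (\<lambda>b. F b - F 0 = integral {0..b} f) at_top"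
    by (intro eventually_at_top_linorderI[of 0]) simp
  moreover have "((\<lambda>b. F b - F 0) \<longlongrightarrow> 0 - F 0) at_top"
    by (intro tendsto_intros lim)
  ultimately have "((\<lambda>b. integral {0..b} f) \<longlongrightarrow> 0 - F 0) at_top"
    by (rule Lim_transform_eventually[rotated])
  with tendsto_integral_Ici[OF int] have "integral {0..} f = 0 - F 0"
    using tendsto_unique[OF trivial_limit_at_top_linorder] by blast
  thus ?thesis by simp
qed

lemma norm_exp_minus_one_plus: "norm (exp (- w) - 1 + w) \<le> exp (norm w) * (norm w)\<^sup>2" for w :: complex
  using Taylor_exp_field[of "-w" 1] by (simp add: power2_eq_square algebra_simps)

text \<open>Differentiation under the integral sign by a direct estimate: the second-order remainder
  of \<open>exp (- h s)\<close> is at most |h|^2 s^2 exp(|h| s), and its integral against the rest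
  is bounded uniformly for small \<open>h\<close>. Dividing by \<open>h\<close> leaves an error of
  order |h|.\<close>

lemma has_field_derivative_laplace:
  assumes g: "exp_decay k g" and p: "Re p + k > 0"
  shows "((\<lambda>p. integral {0..} (\<lambda>s. exp (- (p * of_real s)) * g s)) has_field_derivative
           - integral {0..} (\<lambda>s. exp (- (p * of_real s)) * (of_real s * g s))) (at p)"
proof -
  \<comment> \<open>The margin \<open>Re p + k\<close> is split into four equal shares: two pay for
    the two factors \<open>s\<close>, one for \<open>exp (norm h * s)\<close> with
    \<open>norm h\<close> \<le> \<open>e\<close>, and the last one keeps the majorant
    integrable.\<close>
  define e where "e = (Re p + k) / 4"
  have e: "e > 0" "Re p + k = 4 * e" using p by (auto simp: e_def)
  define G where "G p = integral {0..} (\<lambda>s. exp (- (p * of_real s)) * g s)" for p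
  define D where "D = integral {0..} (\<lambda>s. exp (- (p * of_real s)) * (of_real s * g s))"
  obtain C where C: "C > 0" "\<And>s. s \<ge> 0 \<Longrightarrow> norm (of_real s * (of_real s * g s)) \<le> C * exp (- ((k - 2 * e) * s))"
    using exp_decayE[OF exp_decay_of_real_mult[OF exp_decay_of_real_mult[OF g, of "k - e"], of "k - 2 * e"]] e
    by (metis diff_less_eq less_add_same_cancel1 mult_2 add_diff_cancel_left' diff_diff_eq)
  define M where "M = integral {0..} (\<lambda>s. C * exp (- (e * s)))"
  have intM: "(\<lambda>s. C * exp (- (e * s))) integrable_on {0..}"
    using integrable_on_exp_minus_to_infinity[OF e(1), of 0] by (intro integrable_on_mult_right) simp
  have bound: "norm (G (p + h) - G p + h * D) \<le> (norm h)\<^sup>2 * M" if h: "norm h \<le> e" for h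
  proof -
    have "\<bar>Re h\<bar> \<le> e" using abs_Re_le_cmod[of h] h by linarith
    hence 1: "Re (p + h) + k > 0" using e by auto
    have i1: "(\<lambda>s. exp (- ((p + h) * of_real s)) * g s) integrable_on {0..}"
      by (rule exp_decay_integrable[OF exp_decay_mult[OF exp_decay_exp g] 1])
    have i2: "(\<lambda>s. exp (- (p * of_real s)) * g s) integrable_on {0..}"
      by (rule exp_decay_integrable[OF exp_decay_mult[OF exp_decay_exp g] p])
    have i3: "(\<lambda>s. exp (- (p * of_real s)) * (of_real s * g s)) integrable_on {0..}"
      by (rule exp_decay_integrable[OF exp_decay_mult[OF exp_decay_exp exp_decay_of_real_mult[OF g, of "k - e"]]])
         (use e in auto)
    let ?I = "\<lambda>s. exp (- ((p + h) * of_real s)) * g s - exp (- (p * of_real s)) * g s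
          + h * (exp (- (p * of_real s)) * (of_real s * g s))"
    have "G (p + h) - G p + h * D = integral {0..} ?I"
      unfolding G_def D_def using i1 i2 i3
      by (simp add: integral_add integral_diff integrable_diff integrable_on_mult_right)
    also have "norm (integral {0..} ?I) \<le> integral {0..} (\<lambda>s. (norm h)\<^sup>2 * (C * exp (- (e * s))))"
    proof (rule integral_norm_bound_integral)
      show "?I integrable_on {0..}" using i1 i2 i3 by (intro integrable_add integrable_diff integrable_on_mult_right)
      show "(\<lambda>s. (norm h)\<^sup>2 * (C * exp (- (e * s)))) integrable_on {0..}"
        using intM by (rule integrable_on_mult_right)
      fix s :: real assume "s \<in> {0..}" hence s: "s \<ge> 0" by simp
      have eh: "exp (- ((p + h) * of_real s)) = exp (- (p * of_real s)) * exp (- (h * of_real s))"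
        by (simp add: distrib_right flip: exp_add)
      have "?I s = exp (- (p * of_real s)) * g s * (exp (- (h * of_real s)) - 1 + h * of_real s)"
        unfolding eh by (simp add: algebra_simps)
      also have "norm \<dots> \<le> (exp (- (Re p * s)) * norm (g s)) * (exp (norm h * s) * (norm h * s)\<^sup>2)"
        using norm_exp_minus_one_plus[of "h * of_real s"] s
        by (simp add: norm_mult mult_left_mono)
      also have "\<dots> = (norm h)\<^sup>2 * (exp (- (Re p * s)) * exp (norm h * s) * norm (of_real s * (of_real s * g s)))"
        using s by (simp add: norm_mult power2_eq_square)
      also have "\<dots> \<le> (norm h)\<^sup>2 * (exp (- (Re p * s)) * exp (e * s) * (C * exp (- ((k - 2 * e) * s))))"
        using s h C by (intro mult_left_mono mult_mono) (auto intro: mult_right_mono)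
      also have "exp (- (Re p * s)) * exp (e * s) * (C * exp (- ((k - 2 * e) * s))) =
          C * exp (- (Re p * s) + e * s - (k - 2 * e) * s)"
        by (simp add: algebra_simps flip: exp_add)
      also have "- (Re p * s) + e * s - (k - 2 * e) * s = - (e * s)"
        using e(2) by (simp add: algebra_simps) (metis add.commute distrib_right mult.assoc mult.commute)
      finally show "norm (?I s) \<le> (norm h)\<^sup>2 * (C * exp (- (e * s)))" .
    qed
    also have "\<dots> = (norm h)\<^sup>2 * M" unfolding M_def by simp
    finally show ?thesis .
  qed
  have "((\<lambda>h. (G (p + h) - G p) / h - (- D)) \<longlongrightarrow> 0) (at 0)"
  proof (rule Lim_null_comparison)
    show "eventually (\<lambda>h. norm ((G (p + h) - G p) / h - (- D)) \<le> norm h * M) (at 0)"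
      unfolding eventually_at
    proof (intro exI[of _ e] conjI ballI impI)
      fix h :: complex assume "h \<noteq> 0 \<and> dist h 0 < e"
      hence h: "h \<noteq> 0" "norm h \<le> e" by auto
      have "(G (p + h) - G p) / h - (- D) = (G (p + h) - G p + h * D) / h"
        using h by (simp add: field_simps)
      also have "norm \<dots> \<le> (norm h)\<^sup>2 * M / norm h"
        unfolding norm_divide using h by (intro divide_right_mono bound) auto
      finally show "norm ((G (p + h) - G p) / h - (- D)) \<le> norm h * M"
        using h by (simp add: power2_eq_square)
    qed (use e in auto)
    show "((\<lambda>h. norm h * M) \<longlongrightarrow> 0) (at (0::complex))"
      by (rule tendsto_eq_intros | simp)+
  qed
  hence "((\<lambda>h. (G (p + h) - G p) / h) \<longlongrightarrow> - D) (at 0)"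
    by (rule LIM_zero_cancel)
  thus ?thesis unfolding DERIV_def G_def D_def .
qed

section \<open>The parabolic cylinder equation and its recessive solution\<close>

text \<open>The differential half of \<open>is_pcU\<close>. It is separated because rotated
  functions such as U(a,iz) solve an equation of the same type, with a changed parameter, but have
  other asymptotics.\<close>

definition pc_ode :: "complex \<Rightarrow> (complex \<Rightarrow> complex) \<Rightarrow> bool" where
  "pc_ode a f \<longleftrightarrow> f holomorphic_on UNIV \<and> (\<forall>z. deriv (deriv f) z = (z\<^sup>2 / 4 + a) * f z)"

definition pc_lead :: "complex \<Rightarrow> complex \<Rightarrow> complex" where
  "pc_lead a z = z powr (- a - 1/2) * exp (- z\<^sup>2 / 4)"

lemma pc_ode_deriv:
  assumes "pc_ode a f"
  shows "(f has_field_derivative deriv f z) (at z)"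
    and "(deriv f has_field_derivative (z\<^sup>2 / 4 + a) * f z) (at z)"
proof -
  have h: "f holomorphic_on UNIV" "deriv f holomorphic_on UNIV"
    using assms by (auto simp: pc_ode_def intro!: holomorphic_deriv)
  show "(f has_field_derivative deriv f z) (at z)"
    by (rule holomorphic_derivI[OF h(1)]) auto
  have "(deriv f has_field_derivative deriv (deriv f) z) (at z)"
    by (rule holomorphic_derivI[OF h(2)]) auto
  thus "(deriv f has_field_derivative (z\<^sup>2 / 4 + a) * f z) (at z)"
    using assms by (simp add: pc_ode_def)
qed

lemma pc_odeI:
  assumes "\<And>z. (f has_field_derivative f' z) (at z)"
    and "\<And>z. (f' has_field_derivative (z\<^sup>2 / 4 + a) * f z) (at z)"
  shows "pc_ode a f"
proof -
  have "deriv f = f'" using assms(1) by (auto intro!: DERIV_imp_deriv)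
  moreover have "f holomorphic_on UNIV"
    using assms(1) by (auto simp: holomorphic_on_open)
  ultimately show ?thesis using assms(2) by (auto simp: pc_ode_def intro!: DERIV_imp_deriv)
qed

lemma pc_ode_continuous:
  assumes "pc_ode a f" "continuous_on A g" shows "continuous_on A (\<lambda>x. f (g x))"
proof -
  have "continuous_on UNIV f"
    using assms by (auto simp: pc_ode_def intro: holomorphic_on_imp_continuous_on)
  thus ?thesis using assms(2) by (rule continuous_on_compose2) auto
qed

lemma pc_ode_continuous_deriv:
  assumes "pc_ode a f" "continuous_on A g" shows "continuous_on A (\<lambda>x. deriv f (g x))"
proof -
  have "continuous_on UNIV (deriv f)"
    using assms by (auto simp: pc_ode_def intro!: holomorphic_on_imp_continuous_on holomorphic_deriv)
  thus ?thesis using assms(2) by (rule continuous_on_compose2) auto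
qed

text \<open>The equation has no first-order term, so the Wronskian has derivative zero.\<close>

lemma pc_ode_wronskian:
  assumes "pc_ode a f" "pc_ode a g"
  shows "f z * deriv g z - deriv f z * g z = f w * deriv g w - deriv f w * g w"
proof -
  have "((\<lambda>z. f z * deriv g z - deriv f z * g z) has_field_derivative
      (f z * ((z\<^sup>2 / 4 + a) * g z) + deriv f z * deriv g z) -
      (deriv f z * deriv g z + ((z\<^sup>2 / 4 + a) * f z) * g z)) (at z)" for z
    by (intro DERIV_diff DERIV_mult' pc_ode_deriv[OF assms(1)] pc_ode_deriv[OF assms(2)])
  hence "((\<lambda>z. f z * deriv g z - deriv f z * g z) has_field_derivative 0) (at z)" for z
    by (simp add: algebra_simps)
  then obtain c where "f z * deriv g z - deriv f z * g z = c" for z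
    using has_field_derivative_zero_constant[of UNIV "\<lambda>z. f z * deriv g z - deriv f z * g z"] by auto
  thus ?thesis by simp
qed

section \<open>Decay of recessive solutions on horizontal rays, and uniqueness\<close>

lemma eventually_imp_exp_decay:
  assumes cont: "continuous_on {0..} g"
    and ev: "eventually (\<lambda>s. norm (g s) \<le> C * exp (- (k * s))) at_top"
  shows "exp_decay k g"
proof -
  obtain S where S: "\<And>s. s \<ge> S \<Longrightarrow> norm (g s) \<le> C * exp (- (k * s))"
    using ev unfolding eventually_at_top_linorder by blast
  have "continuous_on {0..S} (\<lambda>s. norm (g s) * exp (k * s))"
    by (intro continuous_intros continuous_on_subset[OF cont]) auto
  hence "bounded ((\<lambda>s. norm (g s) * exp (k * s)) ` {0..S})"
    by (intro compact_imp_bounded compact_continuous_image) auto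
  then obtain B where B: "\<And>s. s \<in> {0..S} \<Longrightarrow> norm (g s) * exp (k * s) \<le> B"
    unfolding bounded_iff by fastforce
  show ?thesis
  proof (rule exp_decayI[OF cont])
    fix s :: real assume s: "s \<ge> 0"
    show "norm (g s) \<le> max B C * exp (- (k * s))"
    proof (cases "s \<ge> S")
      case True
      thus ?thesis using S[OF True] by (meson exp_ge_zero max.cobounded2 mult_right_mono order_trans)
    next
      case False
      hence "norm (g s) * exp (k * s) \<le> B" using B s by auto
      hence "norm (g s) \<le> B * exp (- (k * s))" by (simp add: exp_minus field_simps)
      thus ?thesis by (meson exp_ge_zero max.cobounded1 mult_right_mono order_trans)
    qed
  qed
qed

lemma quadratic_dominates:
  "eventually (\<lambda>s::real. \<alpha> * (\<beta> + s) + \<gamma> + (\<delta> - (\<rho> + s)\<^sup>2) / 4 \<le> - (k * s)) at_top"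
  by real_asymp

text \<open>On a horizontal ray the complex power grows at most exponentially, since its argument
  factor is bounded, whereas the real part of \<open>z\<^sup>2\<close> grows quadratically. The
  Gaussian therefore wins against every rate \<open>k\<close>.\<close>

lemma pc_lead_bound:
  "eventually (\<lambda>s. norm (pc_lead a (w + of_real s)) \<le> exp (- (k * s))) at_top"
proof -
  define c where "c = - a - 1/2"
  have "eventually (\<lambda>s. \<bar>Re c\<bar> * (cmod w + s) + \<bar>Im c\<bar> * pi + ((Im w)\<^sup>2 - (Re w + s)\<^sup>2) / 4 \<le> - (k * s)) at_top"
    by (rule quadratic_dominates)
  moreover have "eventually (\<lambda>s. s \<ge> cmod w + 1) at_top" by (rule eventually_ge_at_top)
  ultimately show ?thesis
  proof eventually_elim
    case (elim s)
    let ?z = "w + of_real s"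
    have z1: "cmod ?z \<ge> 1" using norm_triangle_ineq2[of "of_real s" "-w"] elim(2)
      by (simp add: add.commute)
    have z2: "cmod ?z \<le> cmod w + s" using norm_triangle_ineq[of w "of_real s"] elim(2)
      by (smt (verit) norm_ge_zero norm_of_real)
    have "cmod ?z powr Re c \<le> cmod ?z powr \<bar>Re c\<bar>" using z1 by (intro powr_mono) auto
    also have "\<dots> \<le> exp (\<bar>Re c\<bar> * cmod ?z)" using powr_le_exp[of "\<bar>Re c\<bar>" 1 "cmod ?z"] by simp
    also have "\<dots> \<le> exp (\<bar>Re c\<bar> * (cmod w + s))" using z2 by (simp add: mult_left_mono)
    finally have 1: "cmod ?z powr Re c \<le> exp (\<bar>Re c\<bar> * (cmod w + s))" .
    have "- Im c * Arg ?z \<le> \<bar>Im c\<bar> * \<bar>Arg ?z\<bar>" by (metis abs_ge_self abs_mult abs_minus_cancel)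
    also have "\<dots> \<le> \<bar>Im c\<bar> * pi" using mpi_less_Arg[of ?z] Arg_le_pi[of ?z] by (intro mult_left_mono) auto
    finally have 2: "exp (- Im c * Arg ?z) \<le> exp (\<bar>Im c\<bar> * pi)" by simp
    have 3: "Re (- ?z\<^sup>2 / 4) = ((Im w)\<^sup>2 - (Re w + s)\<^sup>2) / 4" by (simp add: Re_power2 diff_divide_distrib)
    have "norm (pc_lead a ?z) = cmod ?z powr Re c * exp (- Im c * Arg ?z) * exp (Re (- ?z\<^sup>2 / 4))"
      unfolding pc_lead_def c_def[symmetric] norm_mult norm_powr_complex norm_exp_eq_Re ..
    also have "\<dots> \<le> exp (\<bar>Re c\<bar> * (cmod w + s)) * exp (\<bar>Im c\<bar> * pi) * exp (Re (- ?z\<^sup>2 / 4))"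
      by (intro mult_mono 1 2 order_refl) auto
    also have "\<dots> \<le> exp (- (k * s))" using elim(1) unfolding 3 by (simp flip: exp_add)
    finally show ?case .
  qed
qed

lemma pc_exp_decay:
  assumes f: "pc_ode a f"
    and lim: "((\<lambda>s. f (w + of_real s) / pc_lead a (w + of_real s)) \<longlongrightarrow> 1) at_top"
  shows "exp_decay k (\<lambda>s. f (w + of_real s))"
proof (rule eventually_imp_exp_decay)
  show "continuous_on {0..} (\<lambda>s. f (w + of_real s))"
    by (intro pc_ode_continuous[OF f] continuous_intros)
  have "((\<lambda>s. norm (f (w + of_real s) / pc_lead a (w + of_real s))) \<longlongrightarrow> 1) at_top"
    using tendsto_norm[OF lim] by simp
  hence "eventually (\<lambda>s. norm (f (w + of_real s) / pc_lead a (w + of_real s)) < 2) at_top"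
    by (rule order_tendstoD) simp
  moreover have "eventually (\<lambda>s::real. s > cmod w) at_top" by (rule eventually_gt_at_top)
  ultimately show "eventually (\<lambda>s. norm (f (w + of_real s)) \<le> 2 * exp (- (k * s))) at_top"
    using pc_lead_bound[of a w k]
  proof eventually_elim
    case (elim s)
    have "w + of_real s \<noteq> 0"
    proof
      assume "w + of_real s = 0"
      hence "cmod w = \<bar>s\<bar>" by (metis add_eq_0_iff norm_minus_cancel norm_of_real)
      thus False using elim(2) by simp
    qed
    hence "pc_lead a (w + of_real s) \<noteq> 0" by (simp add: pc_lead_def)
    hence "norm (f (w + of_real s)) \<le> 2 * norm (pc_lead a (w + of_real s))"
      using elim(1) by (simp add: norm_divide field_simps)
    also have "\<dots> \<le> 2 * exp (- (k * s))" using elim(3) by simp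
    finally show ?case .
  qed
qed

text \<open>The asymptotic hypothesis concerns \<open>f\<close> only, so decay of the derivative
  must be derived. Taylor expansion over a unit step writes f'(z) as f(z+1) - f(z) minus a remainder
  controlled by f'', and f'' decays by the differential equation.\<close>

lemma pc_exp_decay_deriv:
  assumes f: "pc_ode a f" and dec: "\<And>k. exp_decay k (\<lambda>s. f (w + of_real s))"
  shows "exp_decay k (\<lambda>s. deriv f (w + of_real s))"
proof -
  let ?f2 = "\<lambda>z. (z\<^sup>2 / 4 + a) * f z"
  have const: "exp_decay (-1) (\<lambda>s. c)" for c by (rule exp_decay_mono[OF exp_decay_const]) simp
  have lin: "exp_decay (-1) (\<lambda>s. w + of_real s)"
    by (intro exp_decay_add const exp_decay_of_real) simp
  have sq: "exp_decay (-2) (\<lambda>s. 1 / 4 * ((w + of_real s) * (w + of_real s)) + a)"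
    using exp_decay_cmult[OF exp_decay_mult[OF lin lin], of "1/4"]
    by (intro exp_decay_add exp_decay_mono[OF const[of a]]) simp_all
  \<comment> \<open>The quadratic coefficient costs rate 2; as \<open>f\<close> decays at every
    rate, it is used here with rate \<open>k + 2\<close>.\<close>
  have "exp_decay (-2 + (k + 2)) (\<lambda>s. (1 / 4 * ((w + of_real s) * (w + of_real s)) + a) * f (w + of_real s))"
    by (rule exp_decay_mult[OF sq dec])
  hence "exp_decay k (\<lambda>s. ?f2 (w + of_real s))" by (simp add: power2_eq_square)
  then obtain C where C: "C > 0" "\<And>s. s \<ge> 0 \<Longrightarrow> norm (?f2 (w + of_real s)) \<le> C * exp (- (k * s))"
    using exp_decayE by blast
  obtain D where D: "D > 0" "\<And>s. s \<ge> 0 \<Longrightarrow> norm (f (w + of_real s)) \<le> D * exp (- (k * s))"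
    using exp_decayE[OF dec] by blast
  show ?thesis
  proof (rule exp_decayI)
    show "continuous_on {0..} (\<lambda>s. deriv f (w + of_real s))"
      by (intro pc_ode_continuous_deriv[OF f] continuous_intros)
    fix s :: real assume s: "s \<ge> 0"
    \<comment> \<open>Moving along the unit step changes the exponential bound by at most the factor
      \<open>exp \<bar>k\<bar>\<close>, whatever the sign of \<open>k\<close>.\<close>
    have shift: "exp (- (k * (s + t))) \<le> exp \<bar>k\<bar> * exp (- (k * s))" if "t \<in> {0..1}" for t
    proof -
      have "- (k * t) \<le> \<bar>k\<bar> * t" using that by (simp add: abs_if mult_right_mono)
      also have "\<dots> \<le> \<bar>k\<bar>" using that by (simp add: mult_left_le)
      finally show ?thesis by (simp add: distrib_left flip: exp_add)
    qed
    let ?S = "closed_segment (w + of_real s) (w + of_real s + 1)"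
    define F where "F = (\<lambda>i. if i = 0 then f else if i = Suc 0 then deriv f else ?f2)"
    have "norm (F 0 (w + of_real s + 1) - (\<Sum>i\<le>1. F i (w + of_real s) * (w + of_real s + 1 - (w + of_real s)) ^ i / fact i))
          \<le> C * (exp \<bar>k\<bar> * exp (- (k * s))) * norm (w + of_real s + 1 - (w + of_real s)) ^ Suc 1 / fact 1"
    proof (rule complex_Taylor[where S = ?S])
      fix i :: nat and x assume "i \<le> 1"
      thus "(F i has_field_derivative F (Suc i) x) (at x within ?S)"
        using pc_ode_deriv[OF f, of x] by (cases i) (auto simp: F_def intro: has_field_derivative_at_within)
    next
      fix x assume "x \<in> ?S"
      then obtain t where t: "t \<in> {0..1}" "x = w + of_real (s + t)"
        by (auto simp: closed_segment_def algebra_simps scaleR_conv_of_real)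
      have "norm (?f2 x) \<le> C * exp (- (k * (s + t)))" using C(2)[of "s + t"] t s by simp
      also have "\<dots> \<le> C * (exp \<bar>k\<bar> * exp (- (k * s)))" using shift[OF t(1)] C(1) by (intro mult_left_mono) auto
      finally show "cmod (F (Suc 1) x) \<le> C * (exp \<bar>k\<bar> * exp (- (k * s)))" by (simp add: F_def)
    qed auto
    hence 1: "norm (f (w + of_real (s + 1)) - (f (w + of_real s) + deriv f (w + of_real s))) \<le> C * (exp \<bar>k\<bar> * exp (- (k * s)))"
      by (simp add: F_def add_ac)
    have "norm (f (w + of_real (s + 1))) \<le> D * exp (- (k * (s + 1)))" using D(2)[of "s + 1"] s by (simp del: of_real_add)
    also have "\<dots> \<le> D * (exp \<bar>k\<bar> * exp (- (k * s)))" using shift[of 1] D(1) by (intro mult_left_mono) auto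
    finally have 2: "norm (f (w + of_real (s + 1))) \<le> D * (exp \<bar>k\<bar> * exp (- (k * s)))" .
    have tri: "norm z \<le> norm (x - (y + z)) + norm x + norm y" for x y z :: complex
      using norm_triangle_ineq4[of "x - y" "x - (y + z)"] norm_triangle_ineq4[of x y] by simp
    have "norm (deriv f (w + of_real s)) \<le> C * (exp \<bar>k\<bar> * exp (- (k * s))) + D * (exp \<bar>k\<bar> * exp (- (k * s))) + D * exp (- (k * s))"
      using 1 2 D(2)[OF s] tri[where x = "f (w + of_real (s + 1))" and y = "f (w + of_real s)" and z = "deriv f (w + of_real s)"]
      by linarith
    thus "norm (deriv f (w + of_real s)) \<le> (C * exp \<bar>k\<bar> + D * exp \<bar>k\<bar> + D) * exp (- (k * s))"
      by (simp add: algebra_simps)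
  qed
qed

text \<open>Asymptotics on the positive real axis alone suffice. There both solutions and their
  derivatives decay, so the constant Wronskian is 0 and g/f is constant wherever \<open>f\<close>
  has no zero; the common leading term makes that constant 1.\<close>

lemma pc_unique:
  assumes f: "pc_ode a f" and limf: "((\<lambda>x. f (of_real x) / pc_lead a (of_real x)) \<longlongrightarrow> 1) at_top"
    and g: "pc_ode a g" and limg: "((\<lambda>x. g (of_real x) / pc_lead a (of_real x)) \<longlongrightarrow> 1) at_top"
  shows "f = g"
proof -
  have decf: "exp_decay k (\<lambda>s. f (0 + of_real s))" for k
    using limf by (intro pc_exp_decay[OF f]) simp
  have decg: "exp_decay k (\<lambda>s. g (0 + of_real s))" for k
    using limg by (intro pc_exp_decay[OF g]) simp
  define W where "W = f 0 * deriv g 0 - deriv f 0 * g 0"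
  have W: "f z * deriv g z - deriv f z * g z = W" for z
    unfolding W_def by (rule pc_ode_wronskian[OF f g])
  have "exp_decay (1 + 1) (\<lambda>s. f (0 + of_real s) * deriv g (0 + of_real s) - deriv f (0 + of_real s) * g (0 + of_real s))"
    by (intro exp_decay_diff exp_decay_mult decf decg pc_exp_decay_deriv[OF f] pc_exp_decay_deriv[OF g])
  from exp_decay_tendsto_0[OF this] have "W = 0" unfolding W by (simp add: tendsto_const_iff)
  \<comment> \<open>The quotient g/f is formed only beyond the last real zero of \<open>f\<close>;
    such a point exists because \<open>f\<close> divided by its leading term tends to 1.\<close>
  have "eventually (\<lambda>x. f (of_real x) / pc_lead a (of_real x) \<noteq> 0) at_top"
    using limf by (rule tendsto_imp_eventually_ne) simp
  hence "eventually (\<lambda>x::real. f (of_real x) \<noteq> 0) at_top" by eventually_elim auto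
  then obtain X where X: "\<And>x::real. x \<ge> X \<Longrightarrow> f (of_real x) \<noteq> 0"
    unfolding eventually_at_top_linorder by blast
  define q where "q = (\<lambda>z. g z / f z)"
  have "(q \<circ> of_real has_vector_derivative 0) (at x within {X..})" if "x \<in> {X..}" for x :: real
  proof -
    have "(q has_field_derivative (deriv g (of_real x) * f (of_real x) - g (of_real x) * deriv f (of_real x))
              / (f (of_real x) * f (of_real x))) (at (of_real x))"
      unfolding q_def using X that by (intro DERIV_divide pc_ode_deriv[OF f] pc_ode_deriv[OF g]) auto
    moreover have "deriv g (of_real x) * f (of_real x) - g (of_real x) * deriv f (of_real x) = 0"
      using W[of "of_real x"] \<open>W = 0\<close> by (simp add: mult.commute)
    ultimately have "(q has_field_derivative 0) (at (of_real x))" by simp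
    from has_vector_derivative_real_field[OF this] show ?thesis by (simp add: o_def)
  qed
  then obtain c where c: "\<And>x. x \<in> {X..} \<Longrightarrow> (q \<circ> of_real) x = c"
    using has_vector_derivative_zero_constant[of "{X..}" "q \<circ> of_real"] by auto
  have "((\<lambda>x. (g (of_real x) / pc_lead a (of_real x)) / (f (of_real x) / pc_lead a (of_real x))) \<longlongrightarrow> 1 / 1) at_top"
    by (intro tendsto_divide limf limg) simp
  moreover have "eventually (\<lambda>x::real. (g (of_real x) / pc_lead a (of_real x)) / (f (of_real x) / pc_lead a (of_real x)) = c) at_top"
    using eventually_ge_at_top[of X] eventually_gt_at_top[of 0]
  proof eventually_elim
    case (elim x)
    have "pc_lead a (of_real x) \<noteq> 0" using elim by (simp add: pc_lead_def)
    thus ?case using c[of x] elim by (simp add: q_def)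
  qed
  ultimately have "((\<lambda>x::real. c) \<longlongrightarrow> 1) at_top"
    by (simp add: tendsto_cong)
  hence "c = 1" by (simp add: tendsto_const_iff)
  \<comment> \<open>Equality on a real half-line spreads to the whole plane by the identity theorem,
    since the half-line is connected with more than one point and so has a limit point in
    itself.\<close>
  let ?U = "complex_of_real ` {X..}"
  show "f = g"
  proof
    fix w
    have "f w - g w = 0"
    proof (rule analytic_continuation[of "\<lambda>z. f z - g z" UNIV ?U "of_real X"])
      show "(\<lambda>z. f z - g z) holomorphic_on UNIV"
        using f g by (auto simp: pc_ode_def intro!: holomorphic_intros)
      have "connected ?U" by (intro connected_continuous_image continuous_intros) auto
      moreover have "?U \<noteq> {x}" for x
      proof
        assume "?U = {x}"
        moreover have "of_real X \<in> ?U" "of_real (X + 1) \<in> ?U" by (auto intro!: imageI simp del: of_real_add)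
        ultimately have "complex_of_real (X + 1) = of_real X" by (metis singletonD)
        thus False unfolding of_real_eq_iff by simp
      qed
      ultimately show "of_real X islimpt ?U"
        by (intro connected_imp_perfect) auto
      fix z assume "z \<in> ?U"
      then obtain x where "x \<ge> X" "z = of_real x" by auto
      thus "f z - g z = 0" using c[of x] X[of x] \<open>c = 1\<close> by (auto simp: q_def)
    qed auto
    thus "f w = g w" by simp
  qed
qed

section \<open>Laplace integrals\<close>

text \<open>One family serves two purposes: \<open>c = 0\<close> gives Euler's Gamma integral, hence
  the leading term, and \<open>c = (cis (- \<theta>))\<^sup>2\<close> gives the Laplace
  representation on a rotated ray.\<close>

definition gauss_laplace :: "complex \<Rightarrow> complex \<Rightarrow> complex \<Rightarrow> complex" where
  "gauss_laplace b c p = integral {0..} (\<lambda>s. exp (- (p * of_real s)) *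
     (of_real s powr b * exp (- (c * (of_real s)\<^sup>2 / 2))))"

lemma exp_decay_gauss:
  assumes b: "Re b > 0" and c: "Re c > 0 \<or> c = 0 \<and> k < 0"
  shows "exp_decay k (\<lambda>s. of_real s powr b * exp (- (c * (of_real s)\<^sup>2 / 2)))"
proof (cases "c = 0")
  case True
  thus ?thesis using exp_decay_powr[OF b] c by simp
next
  case False
  with c have c: "Re c > 0" by simp
  \<comment> \<open>One extra unit of rate is reserved for the factor
    \<open>of_real s powr b\<close>, which enters below with rate -1.\<close>
  have "exp_decay (k + 1) (\<lambda>s. exp (- (c * (of_real s)\<^sup>2 / 2)))"
  proof (rule eventually_imp_exp_decay[where C = 1])
    show "eventually (\<lambda>s. norm (exp (- (c * (of_real s)\<^sup>2 / 2))) \<le> 1 * exp (- ((k + 1) * s))) at_top"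
      using eventually_ge_at_top[of "2 * (k + 1) / Re c"] eventually_ge_at_top[of 0]
    proof eventually_elim
      case (elim s)
      have "2 * (k + 1) \<le> Re c * s" using elim c by (simp add: field_simps)
      hence "2 * (k + 1) * s \<le> Re c * s * s" using elim by (intro mult_right_mono)
      thus ?case by (simp add: power2_eq_square algebra_simps flip: of_real_mult)
    qed
  qed (intro continuous_intros, auto)
  from exp_decay_mult[OF exp_decay_powr[OF b] this, of "-1"] show ?thesis by simp
qed

text \<open>This includes \<open>s = 0\<close>, where both sides are 0 because
  \<open>0 powr b = 0\<close> by convention.\<close>

lemma powr_Suc_of_real: "(of_real s :: complex) powr (b + 1) = of_real s * of_real s powr b"
  by (cases "s = 0") (simp_all add: powr_add)

lemma exp_decay_gauss_laplace:
  assumes b: "Re b > 0" and c: "Re c > 0 \<or> c = 0 \<and> Re p > 0"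
  obtains k where "k > 0" "exp_decay k (\<lambda>s. exp (- (p * of_real s)) *
     (of_real s powr b * exp (- (c * (of_real s)\<^sup>2 / 2))))"
proof -
  \<comment> \<open>This makes the total rate \<open>Re p + k\<close> equal to
    \<open>Re p / 2\<close> without the Gaussian, and equal to 1 with it.\<close>
  define k where "k = (if c = 0 then - Re p / 2 else 1 - Re p)"
  have "exp_decay k (\<lambda>s. of_real s powr b * exp (- (c * (of_real s)\<^sup>2 / 2)))"
    by (intro exp_decay_gauss b) (use c in \<open>auto simp: k_def\<close>)
  from exp_decay_mult[OF exp_decay_exp this] show ?thesis
    by (rule that[rotated]) (use c in \<open>auto simp: k_def\<close>)
qed

lemma gauss_laplace_integrable:
  assumes "Re b > 0" "Re c > 0 \<or> c = 0 \<and> Re p > 0"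
  shows "(\<lambda>s. exp (- (p * of_real s)) * (of_real s powr b * exp (- (c * (of_real s)\<^sup>2 / 2)))) integrable_on {0..}"
  using exp_decay_gauss_laplace[OF assms] exp_decay_integrable by blast

lemma has_field_derivative_gauss_laplace:
  assumes b: "Re b > 0" and c: "Re c > 0 \<or> c = 0 \<and> Re p > 0"
  shows "(gauss_laplace b c has_field_derivative - gauss_laplace (b + 1) c p) (at p)"
proof -
  define k where "k = (if c = 0 then - Re p / 2 else 1 - Re p)"
  have 1: "exp_decay k (\<lambda>s. of_real s powr b * exp (- (c * (of_real s)\<^sup>2 / 2)))"
    by (intro exp_decay_gauss b) (use c in \<open>auto simp: k_def\<close>)
  have 2: "Re p + k > 0" using c by (auto simp: k_def)
  have "gauss_laplace b c = (\<lambda>p. integral {0..} (\<lambda>s. exp (- (p * of_real s)) *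
     (of_real s powr b * exp (- (c * (of_real s)\<^sup>2 / 2)))))"
    by (simp add: fun_eq_iff gauss_laplace_def)
  moreover have "gauss_laplace (b + 1) c p = integral {0..} (\<lambda>s. exp (- (p * of_real s)) *
     (of_real s * (of_real s powr b * exp (- (c * (of_real s)\<^sup>2 / 2)))))"
    by (simp add: gauss_laplace_def powr_Suc_of_real mult.assoc)
  ultimately show ?thesis using has_field_derivative_laplace[OF 1 2] by simp
qed

text \<open>Integrate the derivative of s^(b+1) exp(-ps - c s^2/2) over the half-line: the boundary
  terms vanish at both ends, and the three terms of the derivative are the three integrals.\<close>

lemma gauss_laplace_recurrence:
  assumes b: "Re b > 0" and c: "Re c > 0 \<or> c = 0 \<and> Re p > 0"
  shows "(b + 1) * gauss_laplace b c p = c * gauss_laplace (b + 2) c p + p * gauss_laplace (b + 1) c p"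
proof -
  let ?h = "\<lambda>b s. exp (- (p * of_real s)) * (of_real s powr b * exp (- (c * (of_real s)\<^sup>2 / 2)))"
  let ?F = "\<lambda>z. exp (- (p * z)) * (z powr (b + 1) * exp (- (c * z\<^sup>2 / 2)))"
  define f where "f = (\<lambda>s. (b + 1) * ?h b s - (c * ?h (b + 2) s + p * ?h (b + 1) s))"
  obtain k0 where k0: "k0 > 0" "exp_decay k0 (?h b)" using exp_decay_gauss_laplace[OF b c] by blast
  obtain k1 where k1: "k1 > 0" "exp_decay k1 (?h (b + 1))" using exp_decay_gauss_laplace[of "b + 1", OF _ c] b by auto
  obtain k2 where k2: "k2 > 0" "exp_decay k2 (?h (b + 2))" using exp_decay_gauss_laplace[of "b + 2", OF _ c] b by auto
  define k where "k = min k0 (min k1 k2)"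
  have "exp_decay k f" unfolding f_def
    by (intro exp_decay_diff exp_decay_add exp_decay_cmult exp_decay_mono[OF k0(2)]
        exp_decay_mono[OF k1(2)] exp_decay_mono[OF k2(2)]) (auto simp: k_def)
  moreover have "k > 0" using k0 k1 k2 by (simp add: k_def)
  ultimately have f: "f absolutely_integrable_on {0..}" by (rule exp_decay_absolutely_integrable)
  have "integral {0..} f = - ?h (b + 1) 0"
  proof (rule integral_Ici_FTC[OF exp_decay_continuous[OF k1(2)] _ f exp_decay_tendsto_0[OF k1(2,1)]])
    fix s :: real assume s: "s > 0"
    let ?z = "complex_of_real s"
    have nz: "?z \<notin> \<real>\<^sub>\<le>\<^sub>0" using s by simp
    have "?z powr (b + 2) = ?z * ?z powr (b + 1)"
      using powr_Suc_of_real[of s "b + 1"] by (simp add: add.assoc)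
    moreover have "(?F has_field_derivative
        (- p * exp (- (p * ?z))) * (?z powr (b + 1) * exp (- (c * ?z\<^sup>2 / 2))) +
        exp (- (p * ?z)) * ((b + 1) * ?z powr b * exp (- (c * ?z\<^sup>2 / 2)) +
          ?z powr (b + 1) * (- (c * ?z) * exp (- (c * ?z\<^sup>2 / 2))))) (at ?z)"
      using nz by (auto intro!: derivative_eq_intros simp: algebra_simps)
    ultimately have "(?F has_field_derivative f s) (at ?z)"
      by (simp add: f_def algebra_simps)
    from has_vector_derivative_real_field[OF this]
    show "(?h (b + 1) has_vector_derivative f s) (at s)" by simp
  qed
  hence "integral {0..} f = 0" by simp
  also have "integral {0..} f = (b + 1) * gauss_laplace b c p - (c * gauss_laplace (b + 2) c p + p * gauss_laplace (b + 1) c p)"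
    unfolding f_def gauss_laplace_def
    using exp_decay_integrable[OF k0(2,1)] exp_decay_integrable[OF k1(2,1)] exp_decay_integrable[OF k2(2,1)]
    by (simp add: integral_add integral_diff integrable_diff integrable_add integrable_on_mult_right)
  finally show ?thesis by simp
qed

text \<open>For complex \<open>p\<close> no contour is rotated: by the recurrence with
  \<open>c = 0\<close>, the product of \<open>p powr (b + 1)\<close> and the integral has zero
  derivative on the right half-plane, and Euler's integral gives its value at
  \<open>p = 1\<close>.\<close>

lemma gauss_laplace_Gamma:
  assumes b: "Re b > 0" and p: "Re p > 0"
  shows "gauss_laplace b 0 p = Gamma (b + 1) * p powr (- (b + 1))"
proof -
  have der: "((\<lambda>p. p powr (b + 1) * gauss_laplace b 0 p) has_field_derivative 0) (at q within {q. Re q > 0})"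
    if q: "Re q > 0" for q
  proof -
    have nz: "q \<notin> \<real>\<^sub>\<le>\<^sub>0" using q by (auto simp: complex_nonpos_Reals_iff)
    have qn: "q \<noteq> 0" using q by auto
    have "((\<lambda>p. p powr (b + 1) * gauss_laplace b 0 p) has_field_derivative
        q powr (b + 1) * (- gauss_laplace (b + 1) 0 q) + ((b + 1) * q powr b) * gauss_laplace b 0 q) (at q)"
      using has_field_derivative_powr[OF nz, of "b + 1"]
      by (intro DERIV_mult' has_field_derivative_gauss_laplace b) (use q in auto)
    also have "q powr (b + 1) * (- gauss_laplace (b + 1) 0 q) + ((b + 1) * q powr b) * gauss_laplace b 0 q =
        q powr b * ((b + 1) * gauss_laplace b 0 q - q * gauss_laplace (b + 1) 0 q)"
      using qn by (simp add: powr_add algebra_simps)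
    also have "\<dots> = 0" using gauss_laplace_recurrence[OF b, of 0 q] q by simp
    finally show ?thesis by (rule has_field_derivative_at_within)
  qed
  obtain C where C: "\<And>q. Re q > 0 \<Longrightarrow> q powr (b + 1) * gauss_laplace b 0 q = C"
    using has_field_derivative_zero_constant[OF convex_halfspace_Re_gt[of 0] der] by auto
  have "((\<lambda>t. of_real t powr (b + 1 - 1) / of_real (exp t)) has_integral Gamma (b + 1)) {0..}"
    by (rule Gamma_integral_complex) (use b in simp)
  hence "gauss_laplace b 0 1 = Gamma (b + 1)"
    unfolding gauss_laplace_def by (intro integral_unique) (simp add: exp_minus field_simps flip: exp_of_real)
  with C[of 1] have "C = Gamma (b + 1)" by simp
  with C[OF p] have "gauss_laplace b 0 p * p powr (b + 1) = Gamma (b + 1)" by (simp add: mult.commute)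
  moreover have "p powr (b + 1) \<noteq> 0" using p by auto
  ultimately show ?thesis unfolding powr_minus by (metis nonzero_eq_divide_eq divide_inverse)
qed

text \<open>The Laplace integral along the ray \<open>arg t = -\<theta>\<close>, parametrised by \<open>t = s e^(-i\<theta>)\<close>.\<close>

definition pc_rot :: "real \<Rightarrow> complex \<Rightarrow> complex \<Rightarrow> complex" where
  "pc_rot \<theta> a z = exp (- (\<i> * \<theta> * (a + 1/2))) / Gamma (a + 1/2) * exp (- z\<^sup>2 / 4) *
     gauss_laplace (a - 1/2) ((cis (- \<theta>))\<^sup>2) (cis (- \<theta>) * z)"

text \<open>The real part is cos(2 \<theta>). This is what limits the rotation angle: the Gaussian
  must still decay on the rotated ray.\<close>

lemma Re_cis_power2_pos:
  assumes "\<bar>\<theta>\<bar> < pi / 4" shows "Re ((cis (- \<theta>))\<^sup>2) > 0"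
proof -
  have "cos (2 * \<theta>) > 0" using assms by (intro cos_gt_zero_pi) auto
  thus ?thesis by (simp add: cis_mult power2_eq_square)
qed

text \<open>The subtracted term is \<open>(a + 1/2) * pc_rot \<theta> (a + 1) z\<close> in integral
  form, so this is already the recurrence that lowers the derivative to the neighbouring
  parameter.\<close>

lemma has_field_derivative_pc_rot:
  assumes a: "Re a > 1/2" and th: "\<bar>\<theta>\<bar> < pi / 4"
  shows "(pc_rot \<theta> a has_field_derivative - z / 2 * pc_rot \<theta> a z - 
     exp (- (\<i> * \<theta> * (a + 1/2))) / Gamma (a + 1/2) * exp (- z\<^sup>2 / 4) *
       (cis (- \<theta>) * gauss_laplace (a + 1/2) ((cis (- \<theta>))\<^sup>2) (cis (- \<theta>) * z))) (at z)"
proof -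
  define w c where "w = cis (- \<theta>)" and "c = w\<^sup>2"
  have rc: "Re c > 0" using Re_cis_power2_pos[OF th] by (simp add: c_def w_def)
  have "((\<lambda>z. gauss_laplace (a - 1/2) c (w * z)) has_field_derivative (- gauss_laplace (a - 1/2 + 1) c (w * z)) * w) (at z)"
    by (rule DERIV_chain2[OF has_field_derivative_gauss_laplace]) (use a rc in \<open>auto intro!: derivative_eq_intros\<close>)
  moreover have "((\<lambda>z. exp (- z\<^sup>2 / 4)) has_field_derivative - z / 2 * exp (- z\<^sup>2 / 4)) (at z)"
    by (auto intro!: derivative_eq_intros)
  ultimately have "((\<lambda>z. exp (- (\<i> * \<theta> * (a + 1/2))) / Gamma (a + 1/2) * (exp (- z\<^sup>2 / 4) * gauss_laplace (a - 1/2) c (w * z)))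
     has_field_derivative exp (- (\<i> * \<theta> * (a + 1/2))) / Gamma (a + 1/2) * (exp (- z\<^sup>2 / 4) * ((- gauss_laplace (a - 1/2 + 1) c (w * z)) * w)
       + (- z / 2 * exp (- z\<^sup>2 / 4)) * gauss_laplace (a - 1/2) c (w * z))) (at z)"
    by (intro DERIV_cmult DERIV_mult')
  also have "a - 1/2 + 1 = a + 1/2" by simp
  also have "exp (- (\<i> * \<theta> * (a + 1/2))) / Gamma (a + 1/2) * (exp (- z\<^sup>2 / 4) * ((- gauss_laplace (a + 1/2) c (w * z)) * w)
       + (- z / 2 * exp (- z\<^sup>2 / 4)) * gauss_laplace (a - 1/2) c (w * z)) =
     - z / 2 * pc_rot \<theta> a z - exp (- (\<i> * \<theta> * (a + 1/2))) / Gamma (a + 1/2) * exp (- z\<^sup>2 / 4) *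
       (w * gauss_laplace (a + 1/2) c (w * z))"
    unfolding pc_rot_def w_def[symmetric] c_def[symmetric] by (simp add: algebra_simps)
  finally show ?thesis unfolding pc_rot_def w_def c_def by (simp only: mult.assoc)
qed

text \<open>Two differentiations produce the integrals with exponents a - 1/2, a + 1/2 and a + 3/2.
  The recurrence replaces the last two by \<open>(a + 1/2) * I0\<close>, which is just what turns
  the coefficient z^2/4 - 1/2 into z^2/4 + a.\<close>

lemma pc_ode_pc_rot:
  assumes a: "Re a > 1/2" and th: "\<bar>\<theta>\<bar> < pi / 4"
  shows "pc_ode a (pc_rot \<theta> a)"
proof (rule pc_odeI[OF has_field_derivative_pc_rot[OF assms]])
  fix z :: complex
  define w c where "w = cis (- \<theta>)" and "c = w\<^sup>2"
  define K where "K = exp (- (\<i> * \<theta> * (a + 1/2))) / Gamma (a + 1/2)"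
  have rc: "Re c > 0" using Re_cis_power2_pos[OF th] by (simp add: c_def w_def)
  have cw: "c = w\<^sup>2" by (simp add: c_def)
  define E where "E = exp (- z\<^sup>2 / 4)"
  define I0 I1 I2 where "I0 = gauss_laplace (a - 1/2) c (w * z)" and "I1 = gauss_laplace (a + 1/2) c (w * z)"
    and "I2 = gauss_laplace (a + 1/2 + 1) c (w * z)"
  have F: "pc_rot \<theta> a z = K * E * I0" by (simp add: pc_rot_def K_def I0_def c_def w_def E_def)
  have rec: "(a + 1/2) * I0 = w\<^sup>2 * I2 + w * z * I1"
    using gauss_laplace_recurrence[of "a - 1/2" c "w * z"] a rc cw
    unfolding I0_def I1_def I2_def by (simp add: algebra_simps)
  have dF: "(pc_rot \<theta> a has_field_derivative - z / 2 * (K * E * I0) - K * E * (w * I1)) (at z)"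
    using has_field_derivative_pc_rot[OF assms, of z]
    unfolding F K_def[symmetric] w_def[symmetric] c_def[symmetric] E_def[symmetric] I1_def[symmetric] .
  have dI: "((\<lambda>z. gauss_laplace (a + 1/2) c (w * z)) has_field_derivative (- I2) * w) (at z)"
    unfolding I2_def by (rule DERIV_chain2[OF has_field_derivative_gauss_laplace]) (use a rc in \<open>auto intro!: derivative_eq_intros\<close>)
  have dE: "((\<lambda>z. exp (- z\<^sup>2 / 4)) has_field_derivative - z / 2 * E) (at z)"
    unfolding E_def by (auto intro!: derivative_eq_intros)
  have dz: "((\<lambda>z. - z / 2) has_field_derivative - 1 / 2) (at z)"
    by (auto intro!: derivative_eq_intros)
  have "((\<lambda>z. - z / 2 * pc_rot \<theta> a z - K * exp (- z\<^sup>2 / 4) * (w * gauss_laplace (a + 1/2) c (w * z)))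
     has_field_derivative (- z / 2 * (- z / 2 * (K * E * I0) - K * E * (w * I1)) + (- 1 / 2) * pc_rot \<theta> a z)
       - (K * exp (- z\<^sup>2 / 4) * (w * ((- I2) * w)) + (K * (- z / 2 * E)) * (w * gauss_laplace (a + 1/2) c (w * z)))) (at z)"
    by (intro DERIV_diff DERIV_mult' DERIV_cmult dF dI dE dz)
  also have "(- z / 2 * (- z / 2 * (K * E * I0) - K * E * (w * I1)) + (- 1 / 2) * pc_rot \<theta> a z)
       - (K * exp (- z\<^sup>2 / 4) * (w * ((- I2) * w)) + (K * (- z / 2 * E)) * (w * gauss_laplace (a + 1/2) c (w * z)))
     = K * E * ((z\<^sup>2 / 4 - 1/2) * I0 + (w\<^sup>2 * I2 + w * z * I1))"
    unfolding F E_def[symmetric] I1_def[symmetric] by (simp add: algebra_simps power2_eq_square)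
  also have "\<dots> = (z\<^sup>2 / 4 + a) * pc_rot \<theta> a z"
    unfolding rec[symmetric] F by (simp add: algebra_simps)
  finally show "((\<lambda>z. - z / 2 * pc_rot \<theta> a z - exp (- (\<i> * \<theta> * (a + 1/2))) / Gamma (a + 1/2) * exp (- z\<^sup>2 / 4) *
       (cis (- \<theta>) * gauss_laplace (a + 1/2) ((cis (- \<theta>))\<^sup>2) (cis (- \<theta>) * z)))
     has_field_derivative (z\<^sup>2 / 4 + a) * pc_rot \<theta> a z) (at z)"
    unfolding K_def w_def c_def .
qed

section \<open>Leading asymptotics of the rotated Laplace integrals\<close>

lemma norm_exp_minus_one:
  assumes "Re w \<ge> 0" shows "norm (exp (- w) - 1) \<le> norm w"
proof -
  have "norm (exp (- w) - exp (- 0)) \<le> 1 * norm (w - 0)"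
  proof (rule field_differentiable_bound[of "{z. Re z \<ge> 0}"])
    fix z :: complex
    show "((\<lambda>z. exp (- z)) has_field_derivative - exp (- z)) (at z within {z. Re z \<ge> 0})"
      by (auto intro!: derivative_eq_intros)
  qed (use assms in \<open>auto simp: convex_halfspace_Re_ge\<close>)
  thus ?thesis by simp
qed

text \<open>The first step of Watson's lemma: dropping the Gaussian factor costs at most |c| s^2/2
  pointwise, and the extra s^2 raises the exponent of the majorizing Gamma integral by two.\<close>

lemma norm_gauss_laplace_diff:
  assumes b: "Re b > 0" and c: "Re c > 0" and q: "q > 0" "Re p \<ge> q"
  shows "norm (gauss_laplace b c p - gauss_laplace b 0 p) \<le> norm c / 2 * norm (Gamma (of_real (Re b + 3) :: complex)) * q powr (- (Re b + 3))"
proof -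
  let ?h = "\<lambda>b c p s. exp (- (p * of_real s)) * (of_real s powr b * exp (- (c * (of_real s)\<^sup>2 / 2))) :: complex"
  let ?r = "complex_of_real (Re b + 2)" and ?q = "complex_of_real q"
  have i1: "(?h b c p) integrable_on {0..}"
    using b c by (intro gauss_laplace_integrable) auto
  have i2: "(?h b 0 p) integrable_on {0..}"
    using b q by (intro gauss_laplace_integrable) auto
  have i3: "(?h ?r 0 ?q) integrable_on {0..}"
    using b q by (intro gauss_laplace_integrable) auto
  have i4: "((\<lambda>s. norm c / 2 * Re (?h ?r 0 ?q s)) has_integral norm c / 2 * Re (gauss_laplace ?r 0 ?q)) {0..}"
    unfolding gauss_laplace_def
    using has_integral_linear[OF integrable_integral[OF i3] bounded_linear_Re]
    by (intro has_integral_mult_right) (simp add: o_def)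
  have diff: "gauss_laplace b c p - gauss_laplace b 0 p = integral {0..} (\<lambda>s. ?h b c p s - ?h b 0 p s)"
    unfolding gauss_laplace_def using i1 i2 by (simp add: integral_diff)
  have "norm (gauss_laplace b c p - gauss_laplace b 0 p) \<le> integral {0..} (\<lambda>s. norm c / 2 * Re (?h ?r 0 ?q s))"
    unfolding diff
  proof (rule integral_norm_bound_integral)
    show "(\<lambda>s. ?h b c p s - ?h b 0 p s) integrable_on {0..}" by (intro integrable_diff i1 i2)
    show "(\<lambda>s. norm c / 2 * Re (?h ?r 0 ?q s)) integrable_on {0..}" using i4 by blast
    fix s :: real assume "s \<in> {0..}" hence s: "s \<ge> 0" by simp
    have "?h b c p s - ?h b 0 p s = exp (- (p * of_real s)) * of_real s powr b * (exp (- (c * (of_real s)\<^sup>2 / 2)) - 1)"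
      by (simp add: algebra_simps)
    also have "norm \<dots> \<le> (exp (- (Re p * s)) * s powr Re b) * norm (c * (of_real s)\<^sup>2 / 2)"
      unfolding norm_mult[of "exp (- (p * of_real s)) * of_real s powr b"]
      using s c norm_exp_minus_one[of "c * (of_real s)\<^sup>2 / 2"]
      by (intro mult_mono) (auto simp: norm_mult norm_powr_real_powr simp flip: of_real_power)
    also have "\<dots> = norm c / 2 * (exp (- (Re p * s)) * s powr (Re b + 2))"
      using s by (cases "s = 0") (auto simp: norm_mult norm_divide norm_power powr_add)
    also have "\<dots> \<le> norm c / 2 * (exp (- (q * s)) * s powr (Re b + 2))"
      using q s by (intro mult_left_mono mult_right_mono) (auto intro: mult_right_mono)
    also have "exp (- (q * s)) * s powr (Re b + 2) = Re (?h ?r 0 ?q s)"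
      using s by (simp add: powr_of_real Re_exp flip: of_real_add)
    finally show "norm (?h b c p s - ?h b 0 p s) \<le> norm c / 2 * Re (?h ?r 0 ?q s)" .
  qed
  also have "\<dots> = norm c / 2 * Re (gauss_laplace ?r 0 ?q)" using i4 by (rule integral_unique)
  also have "\<dots> \<le> norm c / 2 * norm (gauss_laplace ?r 0 ?q)"
    by (intro mult_left_mono complex_Re_le_cmod) auto
  also have "norm (gauss_laplace ?r 0 ?q) = norm (Gamma (of_real (Re b + 3) :: complex)) * q powr (- (Re b + 3))"
  proof -
    have r: "?r + 1 = of_real (Re b + 3)" by simp
    have "gauss_laplace ?r 0 ?q = Gamma (of_real (Re b + 3)) * ?q powr (- of_real (Re b + 3))"
      unfolding r[symmetric] using b q by (intro gauss_laplace_Gamma) auto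
    thus ?thesis using q by (simp add: norm_mult norm_powr_real_powr)
  qed
  finally show ?thesis by (simp add: mult.assoc)
qed

lemma not_nonpos_Ints_Re_pos:
  assumes "Re z > 0" shows "z \<notin> \<int>\<^sub>\<le>\<^sub>0"
proof
  assume "z \<in> \<int>\<^sub>\<le>\<^sub>0"
  then obtain n where "z = of_int n" "n \<le> 0" by (rule nonpos_Ints_cases)
  thus False using assms by simp
qed

text \<open>With p = e^(-i\<theta>) z the Gamma integral has size |p|^(-Re b - 1) up to constants,
  and the error has size |p|^(-Re b - 3). The relative error is thus O(|z|^(-2)), uniformly while
  \<open>p\<close> stays well inside the right half-plane.\<close>

lemma pc_rot_asymptotic:
  assumes a: "Re a > 1/2" and th: "\<bar>\<theta>\<bar> < pi / 4" and eta: "0 < \<eta>" "\<eta> \<le> pi / 2"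
  shows "((\<lambda>z. pc_rot \<theta> a z / pc_lead a z) \<longlongrightarrow> 1)
           (inf at_infinity (principal {z. \<bar>Arg z - \<theta>\<bar> \<le> pi / 2 - \<eta>}))"
    (is "(_ \<longlongrightarrow> _) ?F")
proof -
  define b where "b = a - 1/2"
  have b: "Re b > 0" using a by (simp add: b_def)
  have ab: "a + 1/2 = b + 1" "- a - 1/2 = - (b + 1)" by (simp_all add: b_def)
  define w c where "w = cis (- \<theta>)" and "c = w\<^sup>2"
  have rc: "Re c > 0" using Re_cis_power2_pos[OF th] by (simp add: c_def w_def)
  have nc: "norm c = 1" by (simp add: c_def w_def norm_power)
  \<comment> \<open>On the sector considered the real part of \<open>w * z\<close> is at least
    \<open>norm z * sin \<eta>\<close>.\<close>
  define \<kappa> where "\<kappa> = sin \<eta>"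
  have kappa: "\<kappa> > 0" unfolding \<kappa>_def using eta by (intro sin_gt_zero) auto
  have G: "Gamma (b + 1) \<noteq> 0"
    using not_nonpos_Ints_Re_pos[of "b + 1"] b by (simp add: Gamma_eq_zero_iff)
  define K where "K = 1 / 2 * norm (Gamma (of_real (Re b + 3) :: complex)) * \<kappa> powr (- (Re b + 3))
     / (norm (Gamma (b + 1)) * exp (- (\<bar>Im b\<bar> * pi)))"
  have bound: "norm (pc_rot \<theta> a z / pc_lead a z - 1) \<le> K * norm z powr (-2)"
    if z: "\<bar>Arg z - \<theta>\<bar> \<le> pi / 2 - \<eta>" "z \<noteq> 0" for z
  proof -
    let ?p = "w * z"
    have pz: "norm ?p = norm z" by (simp add: w_def norm_mult)
    have zr: "z = norm z * cis (Arg z)" using z(2) by (metis Arg_eq cis_conv_exp)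
    have "?p = norm z * cis (Arg z - \<theta>)"
      by (subst zr) (simp add: w_def cis_mult)
    hence "Re ?p = norm z * cos (Arg z - \<theta>)" by simp
    also have "cos (Arg z - \<theta>) = cos \<bar>Arg z - \<theta>\<bar>" by simp
    also have "cos \<bar>Arg z - \<theta>\<bar> \<ge> cos (pi / 2 - \<eta>)"
      using z eta by (intro cos_monotone_0_pi_le) auto
    hence "norm z * cos \<bar>Arg z - \<theta>\<bar> \<ge> norm z * \<kappa>"
      by (intro mult_left_mono) (auto simp: \<kappa>_def cos_diff)
    finally have rp: "Re ?p \<ge> norm z * \<kappa>" .
    have q: "norm z * \<kappa> > 0" using z kappa by simp
    have rp0: "Re ?p > 0" using rp q by linarith
    \<comment> \<open>No branch is crossed, because \<open>Arg z - \<theta>\<close> lies strictly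
      between -pi/2 and pi/2. The phase that this produces in the power is cancelled by the
      prefactor of \<open>pc_rot\<close>.\<close>
    have "Ln ?p = Ln z - \<i> * \<theta>"
    proof (rule Ln_unique)
      show "exp (Ln z - \<i> * \<theta>) = ?p" using z(2) by (simp add: exp_diff w_def cis_conv_exp exp_minus field_simps)
      show "- pi < Im (Ln z - \<i> * \<theta>)" "Im (Ln z - \<i> * \<theta>) \<le> pi"
        using z eta pi_gt_zero by (auto simp: Arg_eq_Im_Ln abs_le_iff)
    qed
    hence "?p powr (- (b + 1)) = exp (- (b + 1) * (Ln z - \<i> * \<theta>))"
      using z(2) by (simp add: powr_def w_def)
    also have "- (b + 1) * (Ln z - \<i> * \<theta>) = - (b + 1) * Ln z + \<i> * \<theta> * (b + 1)"
      by (simp add: algebra_simps)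
    also have "exp \<dots> = z powr (- (b + 1)) * exp (\<i> * \<theta> * (b + 1))"
      using z(2) by (simp add: powr_def exp_add)
    finally have lead: "?p powr (- (b + 1)) = z powr (- (b + 1)) * exp (\<i> * \<theta> * (b + 1))" .
    have I0: "gauss_laplace b 0 ?p = Gamma (b + 1) * ?p powr (- (b + 1))" by (rule gauss_laplace_Gamma[OF b rp0])
    have I0nz: "gauss_laplace b 0 ?p \<noteq> 0" unfolding I0 using G z(2) by (simp add: w_def)
    have F: "pc_rot \<theta> a z = exp (- (\<i> * \<theta> * (b + 1))) / Gamma (b + 1) * exp (- z\<^sup>2 / 4) * gauss_laplace b c ?p"
      unfolding pc_rot_def ab b_def[symmetric] w_def[symmetric] c_def[symmetric] ..
    have "pc_rot \<theta> a z / pc_lead a z = gauss_laplace b c ?p / gauss_laplace b 0 ?p"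
      unfolding I0 lead F pc_lead_def ab by (simp add: exp_minus divide_simps)
    also have "\<dots> - 1 = (gauss_laplace b c ?p - gauss_laplace b 0 ?p) / gauss_laplace b 0 ?p"
      using I0nz by (simp add: diff_divide_distrib)
    finally have "norm (pc_rot \<theta> a z / pc_lead a z - 1) = norm (gauss_laplace b c ?p - gauss_laplace b 0 ?p) / norm (gauss_laplace b 0 ?p)"
      by (simp add: norm_divide)
    also have "\<dots> \<le> (1 / 2 * norm (Gamma (of_real (Re b + 3) :: complex)) * (norm z * \<kappa>) powr (- (Re b + 3)))
       / (norm (Gamma (b + 1)) * (norm z powr (- (Re b + 1)) * exp (- (\<bar>Im b\<bar> * pi))))"
    proof (rule frac_le)
      show "norm (gauss_laplace b c ?p - gauss_laplace b 0 ?p) \<le> 1 / 2 * norm (Gamma (of_real (Re b + 3) :: complex)) * (norm z * \<kappa>) powr (- (Re b + 3))"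
        using norm_gauss_laplace_diff[OF b rc q rp] by (simp add: nc)
      have "- (Im b * Arg ?p) \<le> \<bar>Im b\<bar> * \<bar>Arg ?p\<bar>" by (metis abs_ge_minus_self abs_mult)
      also have "\<dots> \<le> \<bar>Im b\<bar> * pi" using mpi_less_Arg[of ?p] Arg_le_pi[of ?p] by (intro mult_left_mono) auto
      finally have e: "exp (- (\<bar>Im b\<bar> * pi)) \<le> exp (Im b * Arg ?p)" by simp
      have "Re (- (b + 1)) = - (Re b + 1)" "- Im (- (b + 1)) = Im b" by simp_all
      hence "norm (?p powr (- (b + 1))) = norm z powr (- (Re b + 1)) * exp (Im b * Arg ?p)"
        unfolding norm_powr_complex pz by (simp only:)
      thus "norm (Gamma (b + 1)) * (norm z powr (- (Re b + 1)) * exp (- (\<bar>Im b\<bar> * pi))) \<le> norm (gauss_laplace b 0 ?p)"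
        unfolding I0 norm_mult[of "Gamma (b + 1)"] using e by (simp add: mult_left_mono)
    qed (use G z in auto)
    also have "\<dots> = K * norm z powr (-2)"
    proof -
      have "- (Re b + 3) = - (Re b + 1) + (-2)" by simp
      hence "norm z powr (- (Re b + 3)) = norm z powr (- (Re b + 1)) * norm z powr (-2)"
        by (simp only: powr_add)
      moreover have "norm z powr (- (Re b + 1)) > 0" using z by simp
      ultimately show ?thesis using kappa G by (simp add: K_def powr_mult field_simps)
    qed
    finally show ?thesis .
  qed
  have "((\<lambda>z. pc_rot \<theta> a z / pc_lead a z - 1) \<longlongrightarrow> 0) ?F"
  proof (rule Lim_null_comparison)
    have "eventually (\<lambda>z::complex. z \<noteq> 0) at_infinity"
      using eventually_not_equal_at_infinity by blast
    thus "eventually (\<lambda>z. norm (pc_rot \<theta> a z / pc_lead a z - 1) \<le> K * norm z powr (-2)) ?F"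
      unfolding eventually_inf_principal by eventually_elim (use bound in auto)
    have "((\<lambda>x::real. K * x powr (-2)) \<longlongrightarrow> 0) at_top" by real_asymp
    hence "((\<lambda>z::complex. K * norm z powr (-2)) \<longlongrightarrow> 0) at_infinity"
      by (rule filterlim_compose) (rule filterlim_norm_at_top)
    thus "((\<lambda>z::complex. K * norm z powr (-2)) \<longlongrightarrow> 0) ?F"
      by (rule tendsto_mono[OF inf_le1])
  qed
  thus ?thesis by (rule LIM_zero_cancel)
qed

section \<open>Existence and recurrences of the parabolic cylinder function\<close>

lemma is_pcU_iff:
  "is_pcU a f \<longleftrightarrow> pc_ode a f \<and> (\<forall>\<delta>>0. ((\<lambda>z. f z / pc_lead a z) \<longlongrightarrow> 1) (inf at_infinity (principal (pc_sector \<delta>))))"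
  by (auto simp: is_pcU_def pc_ode_def pc_lead_def)

text \<open>With opening parameter pi/4 the sector is |Arg z| \<le> pi/2, which every horizontal ray
  to the right eventually enters.\<close>

lemma filterlim_shifted_real_sector:
  "filterlim (\<lambda>s. w + of_real s) (inf at_infinity (principal (pc_sector (pi / 4)))) at_top"
proof (subst filterlim_inf, intro conjI)
  have lim: "filterlim (\<lambda>s. - cmod w + s) at_top at_top" by real_asymp
  have "- cmod w + s \<le> norm (w + of_real s)" for s
    using norm_triangle_ineq2[of "of_real s" "-w"] abs_ge_self[of s] by (simp add: add.commute)
  thus "filterlim (\<lambda>s. w + of_real s) at_infinity at_top"
    unfolding filterlim_at_infinity_conv_norm_at_top
    by (intro filterlim_at_top_mono[OF lim] always_eventually allI)
  show "filterlim (\<lambda>s. w + of_real s) (principal (pc_sector (pi / 4))) at_top"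
    unfolding filterlim_principal using eventually_gt_at_top[of "- Re w"]
  proof eventually_elim
    case (elim s)
    hence "\<bar>Arg (w + of_real s)\<bar> < pi / 2" by (subst Arg_Re_pos) auto
    thus ?case by (simp add: pc_sector_def)
  qed
qed

lemma is_pcU_tendsto_real:
  assumes "is_pcU a f"
  shows "((\<lambda>s. f (w + of_real s) / pc_lead a (w + of_real s)) \<longlongrightarrow> 1) at_top"
proof -
  have "((\<lambda>z. f z / pc_lead a z) \<longlongrightarrow> 1) (inf at_infinity (principal (pc_sector (pi / 4))))"
    using assms by (simp add: is_pcU_iff)
  thus ?thesis by (rule filterlim_compose) (rule filterlim_shifted_real_sector)
qed

lemma is_pcU_unique:
  assumes "is_pcU a f" "is_pcU a g" shows "f = g"
  using assms is_pcU_tendsto_real[OF assms(1), of 0] is_pcU_tendsto_real[OF assms(2), of 0]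
  by (intro pc_unique[of a]) (auto simp: is_pcU_iff)

lemma pcU_eq: "is_pcU a f \<Longrightarrow> pcU a = f"
  unfolding pcU_def by (rule the_equality) (auto intro: is_pcU_unique)

lemma pc_rot_tendsto_real:
  assumes a: "Re a > 1/2" and th: "\<bar>\<theta>\<bar> < pi / 4"
  shows "((\<lambda>s. pc_rot \<theta> a (of_real s) / pc_lead a (of_real s)) \<longlongrightarrow> 1) at_top"
proof (rule filterlim_compose[OF pc_rot_asymptotic[OF assms, of "pi / 4"]])
  show "filterlim of_real (inf at_infinity (principal {z. \<bar>Arg z - \<theta>\<bar> \<le> pi / 2 - pi / 4})) at_top"
  proof (subst filterlim_inf, intro conjI)
    show "filterlim (of_real :: real \<Rightarrow> complex) at_infinity at_top"
      unfolding filterlim_at_infinity_conv_norm_at_top by (simp add: filterlim_abs_real)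
    show "filterlim of_real (principal {z. \<bar>Arg z - \<theta>\<bar> \<le> pi / 2 - pi / 4}) (at_top :: real filter)"
      unfolding filterlim_principal using eventually_gt_at_top[of 0]
      by eventually_elim (use th in simp)
  qed
qed (use pi_gt_zero in simp_all)

lemma pc_rot_rotate:
  assumes a: "Re a > 1/2" and th: "\<bar>\<theta>\<bar> < pi / 4"
  shows "pc_rot \<theta> a = pc_rot 0 a"
  by (rule pc_unique[of a]) (use assms in \<open>auto intro!: pc_ode_pc_rot pc_rot_tendsto_real\<close>)

lemma is_pcU_pc_rot:
  assumes a: "Re a > 1/2" shows "is_pcU a (pc_rot 0 a)"
  unfolding is_pcU_iff
proof (intro conjI allI impI)
  show "pc_ode a (pc_rot 0 a)" by (rule pc_ode_pc_rot) (use a in auto)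
  fix \<delta> :: real assume \<delta>: "\<delta> > 0"
  \<comment> \<open>The sector around \<theta> = pi/4 - \<eta> reaches from -pi/4 up to 3 pi/4 - 2
    \<eta>, and 2 \<eta> \<le> \<delta>. Together with its mirror image it therefore covers
    \<open>pc_sector \<delta>\<close>.\<close>
  define \<eta> where "\<eta> = min \<delta> (pi / 4) / 2"
  define \<theta> where "\<theta> = pi / 4 - \<eta>"
  define A where "A = (\<lambda>\<theta>. {z. \<bar>Arg z - \<theta>\<bar> \<le> pi / 2 - \<eta>})"
  have eta: "0 < \<eta>" "\<eta> \<le> pi / 8" "2 * \<eta> \<le> \<delta>" using \<delta> by (auto simp: \<eta>_def)
  have th: "\<bar>\<theta>\<bar> < pi / 4" "\<bar>- \<theta>\<bar> < pi / 4" using eta by (auto simp: \<theta>_def)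
  have "((\<lambda>z. pc_rot 0 a z / pc_lead a z) \<longlongrightarrow> 1) (inf at_infinity (principal (A \<theta>)))"
    using pc_rot_asymptotic[OF a th(1), of \<eta>] eta pc_rot_rotate[OF a th(1)] by (simp add: A_def)
  moreover have "((\<lambda>z. pc_rot 0 a z / pc_lead a z) \<longlongrightarrow> 1) (inf at_infinity (principal (A (- \<theta>))))"
    using pc_rot_asymptotic[OF a th(2), of \<eta>] eta pc_rot_rotate[OF a th(2)] by (simp add: A_def)
  ultimately have "((\<lambda>z. pc_rot 0 a z / pc_lead a z) \<longlongrightarrow> 1)
      (sup (inf at_infinity (principal (A \<theta>))) (inf at_infinity (principal (A (- \<theta>)))))"
    by (rule filterlim_sup)
  hence "((\<lambda>z. pc_rot 0 a z / pc_lead a z) \<longlongrightarrow> 1) (inf at_infinity (principal (A \<theta> \<union> A (- \<theta>))))"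
    by (simp flip: inf_sup_distrib1)
  moreover have "pc_sector \<delta> \<subseteq> A \<theta> \<union> A (- \<theta>)"
  proof
    fix z assume "z \<in> pc_sector \<delta>"
    hence z: "\<bar>Arg z\<bar> \<le> 3 * pi / 4 - \<delta>" by (simp add: pc_sector_def)
    show "z \<in> A \<theta> \<union> A (- \<theta>)"
      using z eta by (cases "Arg z \<ge> 0") (auto simp: A_def \<theta>_def abs_le_iff)
  qed
  hence "inf at_infinity (principal (pc_sector \<delta>)) \<le> inf at_infinity (principal (A \<theta> \<union> A (- \<theta>)))"
    by (intro inf_mono) auto
  ultimately show "((\<lambda>z. pc_rot 0 a z / pc_lead a z) \<longlongrightarrow> 1) (inf at_infinity (principal (pc_sector \<delta>)))"
    using tendsto_mono by blast
qed

section \<open>Existence for all parameters by descending in the parameter\<close>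

definition pc_pair :: "complex \<Rightarrow> (complex \<Rightarrow> complex) \<Rightarrow> (complex \<Rightarrow> complex) \<Rightarrow> bool" where
  "pc_pair a f g \<longleftrightarrow> is_pcU a f \<and> is_pcU (a + 1) g \<and> (\<forall>z. deriv f z = - z / 2 * f z - (a + 1/2) * g z)"

lemma pc_pair_pc_rot:
  assumes a: "Re a > 1/2" shows "pc_pair a (pc_rot 0 a) (pc_rot 0 (a + 1))"
  unfolding pc_pair_def
proof (intro conjI allI)
  show "is_pcU a (pc_rot 0 a)" "is_pcU (a + 1) (pc_rot 0 (a + 1))"
    by (rule is_pcU_pc_rot; use a in simp)+
  fix z
  have nz: "a + 1/2 \<noteq> 0" using a by (auto simp: complex_eq_iff)
  have "a + 1/2 \<notin> \<int>\<^sub>\<le>\<^sub>0" by (rule not_nonpos_Ints_Re_pos) (use a in simp)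
  hence "Gamma (a + 1/2 + 1) = (a + 1/2) * Gamma (a + 1/2)" by (intro Gamma_plus1)
  moreover have "pc_rot 0 (a + 1) z = 1 / Gamma (a + 1/2 + 1) * exp (- z\<^sup>2 / 4) * gauss_laplace (a + 1/2) 1 z"
  proof -
    have "a + 1 + 1/2 = a + 1/2 + 1" "a + 1 - 1/2 = a + 1/2" by simp_all
    thus ?thesis unfolding pc_rot_def by (simp only: of_real_0) simp
  qed
  ultimately have "(a + 1/2) * pc_rot 0 (a + 1) z = 1 / Gamma (a + 1/2) * exp (- z\<^sup>2 / 4) * gauss_laplace (a + 1/2) 1 z"
    using nz by simp
  moreover have "deriv (pc_rot 0 a) z = - z / 2 * pc_rot 0 a z - 1 / Gamma (a + 1/2) * exp (- z\<^sup>2 / 4) * gauss_laplace (a + 1/2) 1 z"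
    using DERIV_imp_deriv[OF has_field_derivative_pc_rot[of a 0 z]] a by simp
  ultimately show "deriv (pc_rot 0 a) z = - z / 2 * pc_rot 0 a z - (a + 1/2) * pc_rot 0 (a + 1) z"
    by simp
qed

lemma pc_lead_minus_1: "z \<noteq> 0 \<Longrightarrow> pc_lead (a - 1) z = z * pc_lead a z"
  using powr_add[of z "- a - 1/2" 1] by (simp add: pc_lead_def add.commute algebra_simps)

lemma pc_lead_nonzero: "z \<noteq> 0 \<Longrightarrow> pc_lead a z \<noteq> 0"
  by (simp add: pc_lead_def)

text \<open>The lowering operator z/2 - d/dz sends U(a,z) to U(a-1,z). Two neighbouring functions
  are carried through the induction because the asymptotics at the new parameter use both of
  them.\<close>

lemma pc_pair_step:
  assumes "pc_pair a f g"
  shows "pc_pair (a - 1) (\<lambda>z. z / 2 * f z - deriv f z) f"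
proof -
  have f: "is_pcU a f" and g: "is_pcU (a + 1) g" and df: "deriv f z = - z / 2 * f z - (a + 1/2) * g z" for z
    using assms by (auto simp: pc_pair_def)
  have ode: "pc_ode a f" using f by (simp add: is_pcU_iff)
  define h where "h = (\<lambda>z. z / 2 * f z - deriv f z)"
  \<comment> \<open>In this form the derivative is gone, so no asymptotic relation has to be
    differentiated: z f(z) supplies the new leading term and \<open>g\<close> is smaller by a factor
    of order z^(-2).\<close>
  have h: "h z = z * f z + (a + 1/2) * g z" for z by (simp add: h_def df)
  have "((\<lambda>z. z / 2) has_field_derivative 1 / 2) (at z)" for z :: complex
    by (auto intro!: derivative_eq_intros)
  hence "(h has_field_derivative (z / 2 * deriv f z + 1 / 2 * f z) - (z\<^sup>2 / 4 + a) * f z) (at z)" for z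
    unfolding h_def by (intro DERIV_diff DERIV_mult' pc_ode_deriv[OF ode])
  moreover have "(z / 2 * deriv f z + 1 / 2 * f z) - (z\<^sup>2 / 4 + a) * f z = - z / 2 * h z - (a - 1/2) * f z" for z
    by (simp add: h_def algebra_simps power2_eq_square)
  ultimately have dh: "(h has_field_derivative - z / 2 * h z - (a - 1/2) * f z) (at z)" for z by simp
  have "((\<lambda>z. - z / 2) has_field_derivative - 1 / 2) (at z)" for z :: complex
    by (auto intro!: derivative_eq_intros)
  hence "((\<lambda>z. - z / 2 * h z - (a - 1/2) * f z) has_field_derivative
     (- z / 2 * (- z / 2 * h z - (a - 1/2) * f z) + - 1 / 2 * h z) - (a - 1/2) * deriv f z) (at z)" for z
    by (intro DERIV_diff DERIV_mult' DERIV_cmult dh pc_ode_deriv[OF ode])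
  moreover have "(- z / 2 * (- z / 2 * h z - (a - 1/2) * f z) + - 1 / 2 * h z) - (a - 1/2) * deriv f z
      = (z\<^sup>2 / 4 + (a - 1)) * h z" for z
    by (simp add: h_def algebra_simps power2_eq_square)
  ultimately have "pc_ode (a - 1) h" by (intro pc_odeI[OF dh]) simp
  moreover have "((\<lambda>z. h z / pc_lead (a - 1) z) \<longlongrightarrow> 1) (inf at_infinity (principal (pc_sector \<delta>)))"
    (is "(_ \<longlongrightarrow> _) ?F") if "\<delta> > 0" for \<delta>
  proof -
    have "((\<lambda>z. inverse z) \<longlongrightarrow> (0 :: complex)) ?F"
      by (rule tendsto_mono[OF inf_le1 tendsto_inverse_0])
    hence "((\<lambda>z. f z / pc_lead a z + (a + 1/2) * (inverse z * inverse z) * (g z / pc_lead (a + 1) z))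
        \<longlongrightarrow> 1 + (a + 1/2) * (0 * 0) * 1) ?F"
      using f g that by (intro tendsto_intros) (auto simp: is_pcU_iff)
    moreover have "eventually (\<lambda>z. f z / pc_lead a z + (a + 1/2) * (inverse z * inverse z) * (g z / pc_lead (a + 1) z)
        = h z / pc_lead (a - 1) z) ?F"
    proof -
      have "eventually (\<lambda>z::complex. z \<noteq> 0) ?F"
        by (rule filter_leD[OF inf_le1]) (rule eventually_not_equal_at_infinity)
      thus ?thesis
      proof eventually_elim
        case (elim z)
        have "pc_lead a z = z * pc_lead (a + 1) z" using pc_lead_minus_1[OF elim, of "a + 1"] by simp
        thus ?case using elim pc_lead_minus_1[OF elim, of a] pc_lead_nonzero[OF elim, of "a + 1"]
          by (simp add: h field_simps)
      qed
    qed
    ultimately show ?thesis using Lim_transform_eventually by fastforce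
  qed
  ultimately have "is_pcU (a - 1) h" by (simp add: is_pcU_iff)
  moreover have "deriv h z = - z / 2 * h z - (a - 1/2) * f z" for z using dh by (rule DERIV_imp_deriv)
  ultimately show ?thesis unfolding pc_pair_def h_def[symmetric] using f by simp
qed

lemma pc_pair_exists: "\<exists>f g. pc_pair a f g"
proof -
  have "\<exists>f g. pc_pair a f g" if "Re a > 1/2 - of_nat n" for a n
    using that
  proof (induction n arbitrary: a)
    case 0
    thus ?case using pc_pair_pc_rot[of a] by auto
  next
    case (Suc n)
    hence "Re (a + 1) > 1/2 - of_nat n" by simp
    then obtain f g where "pc_pair (a + 1) f g" using Suc.IH by blast
    from pc_pair_step[OF this] show ?case by auto
  qed
  moreover obtain n where "of_nat n > 1/2 - Re a" using reals_Archimedean2 by blast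
  ultimately show ?thesis by (metis diff_less_eq add.commute)
qed

lemma is_pcU_pcU: "is_pcU a (pcU a)"
  using pc_pair_exists[of a] pcU_eq unfolding pc_pair_def by metis

lemma deriv_pcU:
  shows "deriv (pcU a) z = - z / 2 * pcU a z - (a + 1/2) * pcU (a + 1) z"
    and "deriv (pcU a) z = z / 2 * pcU a z - pcU (a - 1) z"
proof -
  obtain f g where fg: "pc_pair a f g" using pc_pair_exists by blast
  have eq: "pcU a = f" "pcU (a + 1) = g" using fg by (auto simp: pc_pair_def intro!: pcU_eq)
  show "deriv (pcU a) z = - z / 2 * pcU a z - (a + 1/2) * pcU (a + 1) z"
    using fg by (simp add: pc_pair_def eq)
  have "pcU (a - 1) = (\<lambda>z. z / 2 * f z - deriv f z)"
    using pc_pair_step[OF fg] by (auto simp: pc_pair_def intro!: pcU_eq)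
  thus "deriv (pcU a) z = z / 2 * pcU a z - pcU (a - 1) z" by (simp add: eq)
qed

lemma pc_ode_pcU: "pc_ode a (pcU a)"
  using is_pcU_pcU[of a] by (simp add: is_pcU_iff)

lemma exp_decay_pcU:
  shows "exp_decay k (\<lambda>s. pcU a (w + of_real s))"
    and "exp_decay k (\<lambda>s. deriv (pcU a) (w + of_real s))"
proof -
  show *: "exp_decay k (\<lambda>s. pcU a (w + of_real s))" for k
    by (rule pc_exp_decay[OF pc_ode_pcU is_pcU_tendsto_real[OF is_pcU_pcU]])
  show "exp_decay k (\<lambda>s. deriv (pcU a) (w + of_real s))"
    by (rule pc_exp_decay_deriv[OF pc_ode_pcU *])
qed

section \<open>Wronskians\<close>

text \<open>The substitution t = s^2/2 turns the Gaussian moment into a Gamma integral. It is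
  carried out on bounded intervals and passed to the limit; the power of 2 is written as an
  exponential to match the duplication formula.\<close>

lemma gauss_laplace_1_0:
  assumes b: "Re b > 1"
  shows "gauss_laplace b 1 0 = exp ((b - 1) / 2 * of_real (ln 2)) * Gamma ((b + 1) / 2)"
proof -
  \<comment> \<open>The exponent after substitution; \<open>Re b > 1\<close> makes its real part
    positive, as \<open>gauss_laplace_Gamma\<close> requires.\<close>
  define c where "c = (b - 1) / 2"
  have c: "Re c > 0" using b by (simp add: c_def)
  define f where "f = (\<lambda>t. exp (- (1 * of_real t)) * (of_real t powr c * exp (- (0 * (of_real t)\<^sup>2 / 2))) :: complex)"
  define g where "g = (\<lambda>s. exp (- (0 * of_real s)) * (of_real s powr b * exp (- (1 * (of_real s)\<^sup>2 / 2))) :: complex)"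
  obtain k where k: "k > 0" "exp_decay k f"
    unfolding f_def using exp_decay_gauss_laplace[of c 0 1] c by auto
  obtain l where l: "l > 0" "exp_decay l g"
    unfolding g_def using exp_decay_gauss_laplace[of b 1 0] b by auto
  define K where "K = exp (c * complex_of_real (ln 2))"
  have eq: "integral {0..n} g = K * integral {0..n\<^sup>2 / 2} f" if n: "n \<ge> 0" for n :: real
  proof -
    have "((\<lambda>s. s *\<^sub>R f (s\<^sup>2 / 2)) has_integral integral {0\<^sup>2 / 2..n\<^sup>2 / 2} f) {0..n}"
    proof (rule has_integral_substitution[where c = 0 and d = "n\<^sup>2 / 2"])
      show "(\<lambda>s. s\<^sup>2 / 2) ` {0..n} \<subseteq> {0..n\<^sup>2 / 2}" by (auto intro!: power_mono)
      show "continuous_on {0..n\<^sup>2 / 2} f"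
        by (rule continuous_on_subset[OF exp_decay_continuous[OF k(2)]]) auto
    qed (use n in \<open>auto intro!: derivative_eq_intros\<close>)
    hence "((\<lambda>s. K * (s *\<^sub>R f (s\<^sup>2 / 2))) has_integral K * integral {0..n\<^sup>2 / 2} f) {0..n}"
      by (intro has_integral_mult_right) simp
    moreover have "K * (s *\<^sub>R f (s\<^sup>2 / 2)) = g s" if "s \<in> {0..n}" for s
    proof (cases "s = 0")
      case False
      with that have s: "s > 0" by simp
      have "ln (s\<^sup>2 / 2) = 2 * ln s - ln 2" using s by (simp add: ln_div ln_realpow)
      hence "of_real (s\<^sup>2 / 2) powr c = exp (c * (2 * of_real (ln s) - of_real (ln 2)))"
        using s by (simp add: powr_def Ln_of_real del: of_real_divide of_real_power)
      moreover have "of_real s powr b = exp (c * 2 * of_real (ln s) + of_real (ln s))"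
        using s by (simp add: powr_def Ln_of_real c_def field_simps)
      moreover have "exp (complex_of_real (ln s)) = of_real s" using s exp_of_real[of "ln s"] by simp
      ultimately show ?thesis
        by (simp add: f_def g_def K_def scaleR_conv_of_real exp_add exp_diff right_diff_distrib mult_ac)
    qed (simp add: g_def)
    ultimately have "(g has_integral K * integral {0..n\<^sup>2 / 2} f) {0..n}"
      by (rule has_integral_eq[rotated])
    thus ?thesis by (rule integral_unique)
  qed
  have "((\<lambda>n. integral {0..n} g) \<longlongrightarrow> integral {0..} g) at_top"
    by (rule tendsto_integral_Ici[OF exp_decay_absolutely_integrable[OF l(2,1)]])
  moreover have "((\<lambda>n. integral {0..n} g) \<longlongrightarrow> K * integral {0..} f) at_top"
  proof -
    have "filterlim (\<lambda>n::real. n\<^sup>2 / 2) at_top at_top" by real_asymp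
    hence "((\<lambda>n. K * integral {0..n\<^sup>2 / 2} f) \<longlongrightarrow> K * integral {0..} f) at_top"
      by (intro tendsto_mult_left filterlim_compose[OF tendsto_integral_Ici[OF exp_decay_absolutely_integrable[OF k(2,1)]]])
    moreover have "eventually (\<lambda>n. K * integral {0..n\<^sup>2 / 2} f = integral {0..n} g) at_top"
      using eventually_ge_at_top[of 0] by eventually_elim (simp add: eq)
    ultimately show ?thesis by (rule Lim_transform_eventually)
  qed
  ultimately have "integral {0..} g = K * integral {0..} f"
    by (rule tendsto_unique[OF trivial_limit_at_top_linorder])
  hence "gauss_laplace b 1 0 = K * gauss_laplace c 0 1" by (simp add: gauss_laplace_def f_def g_def)
  also have "gauss_laplace c 0 1 = Gamma (c + 1)" using gauss_laplace_Gamma[OF c, of 1] by simp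
  also have "c + 1 = (b + 1) / 2" by (simp add: c_def field_simps)
  finally show ?thesis by (simp add: K_def c_def)
qed

text \<open>The left side is the Wronskian of U(a,z) and U(a,-z), evaluated at 0. Using the
  reciprocal Gamma function gives one formula that also covers the poles of Gamma(a + 1/2). It comes
  from Gaussian moments for large Re a and from the recurrences otherwise.\<close>

lemma pcU_0_product:
  "- 2 * pcU a 0 * deriv (pcU a) 0 = of_real (sqrt (2 * pi)) * rGamma (a + 1/2)"
proof -
  have large: "- 2 * pcU a 0 * deriv (pcU a) 0 = of_real (sqrt (2 * pi)) * rGamma (a + 1/2)"
    if a: "Re a > 3/2" for a
  proof -
    \<comment> \<open>With this \<open>w\<close> the values at 0 involve Gamma(w) and Gamma(w +
      1/2), the two factors in Legendre's duplication formula for Gamma(2w).\<close>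
    define w where "w = (a + 1/2) / 2"
    have aw: "a + 1/2 = 2 * w" "a + 1 + 1/2 = 2 * w + 1" by (simp_all add: w_def field_simps)
    have w: "Re w > 1" using a by (simp add: w_def)
    have G: "w \<notin> \<int>\<^sub>\<le>\<^sub>0" "w + 1/2 \<notin> \<int>\<^sub>\<le>\<^sub>0" "2 * w \<notin> \<int>\<^sub>\<le>\<^sub>0"
      using w by (auto intro!: not_nonpos_Ints_Re_pos)
    have g: "Gamma (2 * w) \<noteq> 0" using G by (simp add: Gamma_eq_zero_iff)
    have w0: "w \<noteq> 0" using w by auto
    have a1: "Re a > 1/2" and a2: "Re (a + 1) > 1/2" using a by auto
    have U0: "pcU a 0 = exp ((w - 1) * of_real (ln 2)) * Gamma w / Gamma (2 * w)"
    proof -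
      have "pcU a 0 = gauss_laplace (a - 1/2) 1 0 / Gamma (2 * w)"
        unfolding pcU_eq[OF is_pcU_pc_rot[OF a1]] pc_rot_def aw by simp
      also have "gauss_laplace (a - 1/2) 1 0 = exp ((a - 1/2 - 1) / 2 * of_real (ln 2)) * Gamma ((a - 1/2 + 1) / 2)"
        by (rule gauss_laplace_1_0) (use a in simp)
      also have "(a - 1/2 - 1) / 2 = w - 1" by (simp add: w_def field_simps)
      also have "(a - 1/2 + 1) / 2 = w" by (simp add: w_def field_simps)
      finally show ?thesis .
    qed
    have U1: "pcU (a + 1) 0 = exp ((w - 1/2) * of_real (ln 2)) * Gamma (w + 1/2) / Gamma (2 * w + 1)"
    proof -
      have "pcU (a + 1) 0 = gauss_laplace (a + 1 - 1/2) 1 0 / Gamma (2 * w + 1)"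
        unfolding pcU_eq[OF is_pcU_pc_rot[OF a2]] pc_rot_def aw by simp
      also have "gauss_laplace (a + 1 - 1/2) 1 0 = exp ((a + 1 - 1/2 - 1) / 2 * of_real (ln 2)) * Gamma ((a + 1 - 1/2 + 1) / 2)"
        by (rule gauss_laplace_1_0) (use a in simp)
      also have "(a + 1 - 1/2 - 1) / 2 = w - 1/2" by (simp add: w_def field_simps)
      also have "(a + 1 - 1/2 + 1) / 2 = w + 1/2" by (simp add: w_def field_simps)
      finally show ?thesis .
    qed
    have "- 2 * pcU a 0 * deriv (pcU a) 0 = 2 * (2 * w) * pcU a 0 * pcU (a + 1) 0"
      unfolding deriv_pcU(1) aw by simp
    also have "\<dots> = 2 * (2 * w) * exp ((w - 1) * of_real (ln 2)) * exp ((w - 1/2) * of_real (ln 2)) *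
        (Gamma w * Gamma (w + 1/2)) / (Gamma (2 * w) * Gamma (2 * w + 1))"
      unfolding U0 U1 by simp
    also have "Gamma w * Gamma (w + 1/2) = exp ((1 - 2 * w) * of_real (ln 2)) * of_real (sqrt pi) * Gamma (2 * w)"
      using Gamma_legendre_duplication[OF G(1,2)] by simp
    also have "Gamma (2 * w + 1) = 2 * w * Gamma (2 * w)" by (rule Gamma_plus1[OF G(3)])
    also have "2 * (2 * w) * exp ((w - 1) * of_real (ln 2)) * exp ((w - 1/2) * of_real (ln 2)) *
        (exp ((1 - 2 * w) * of_real (ln 2)) * of_real (sqrt pi) * Gamma (2 * w)) / (Gamma (2 * w) * (2 * w * Gamma (2 * w)))
        = 2 * (exp ((w - 1) * of_real (ln 2)) * exp ((w - 1/2) * of_real (ln 2)) * exp ((1 - 2 * w) * of_real (ln 2))) * of_real (sqrt pi) / Gamma (2 * w)"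
      using g w0 by (simp add: field_simps)
    also have "exp ((w - 1) * of_real (ln 2)) * exp ((w - 1/2) * of_real (ln 2)) * exp ((1 - 2 * w) * of_real (ln 2)) = exp (- (complex_of_real (ln 2) / 2))"
      unfolding exp_add[symmetric] by (simp add: algebra_simps)
    also have "\<dots> = of_real (sqrt 2 / 2)"
    proof -
      have "exp (- (ln 2 / 2)) = sqrt 2 / (2 :: real)"
        by (simp add: exp_minus ln_sqrt[symmetric] real_div_sqrt field_simps)
      thus ?thesis by (metis exp_of_real of_real_minus of_real_divide of_real_numeral)
    qed
    finally show ?thesis unfolding aw rGamma_inverse_Gamma by (simp add: real_sqrt_mult field_simps)
  qed
  have "- 2 * pcU a 0 * deriv (pcU a) 0 = of_real (sqrt (2 * pi)) * rGamma (a + 1/2)"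
    if "Re a > 3/2 - of_nat n" for a n
    using that
  proof (induction n arbitrary: a)
    case 0
    thus ?case using large by simp
  next
    case (Suc n)
    hence "Re (a + 1) > 3/2 - of_nat n" by simp
    note IH = Suc.IH[OF this]
    \<comment> \<open>At 0 both recurrences lose their \<open>z / 2\<close> term. Hence the product
      at \<open>a\<close> is a + 1/2 times the product at a + 1, the same rule that the reciprocal
      Gamma function obeys.\<close>
    have d1: "deriv (pcU a) 0 = - ((a + 1/2) * pcU (a + 1) 0)" using deriv_pcU(1)[of a 0] by simp
    have d2: "deriv (pcU (a + 1)) 0 = - pcU a 0" using deriv_pcU(2)[of "a + 1" 0] by simp
    have "- 2 * pcU a 0 * deriv (pcU a) 0 = (a + 1/2) * (- 2 * pcU (a + 1) 0 * deriv (pcU (a + 1)) 0)"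
      unfolding d1 d2 by simp
    also have "\<dots> = of_real (sqrt (2 * pi)) * ((a + 1/2) * rGamma (a + 1/2 + 1))"
      unfolding IH by (simp add: algebra_simps)
    also have "\<dots> = of_real (sqrt (2 * pi)) * rGamma (a + 1/2)" by (simp only: rGamma_plus1)
    finally show ?case .
  qed
  moreover obtain n where "of_nat n > 3/2 - Re a" using reals_Archimedean2 by blast
  ultimately show ?thesis by (metis diff_less_eq add.commute)
qed

section \<open>Wronskians of rotated solutions from their asymptotics\<close>

lemma pcU_tendsto:
  assumes "\<delta> > 0"
  shows "((\<lambda>z. pcU a z / pc_lead a z) \<longlongrightarrow> 1) (inf at_infinity (principal (pc_sector \<delta>)))"
    and "((\<lambda>z. deriv (pcU a) z / (z * pc_lead a z)) \<longlongrightarrow> - 1 / 2) (inf at_infinity (principal (pc_sector \<delta>)))"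
      (is "(_ \<longlongrightarrow> _) ?F")
proof -
  show 1: "((\<lambda>z. pcU a z / pc_lead a z) \<longlongrightarrow> 1) ?F" for a
    using is_pcU_pcU[of a] assms by (simp add: is_pcU_iff)
  \<comment> \<open>The recurrence gives U' as z/2 U(a,z) - U(a-1,z), and U(a-1,z) behaves like z
    U(a,z), which leaves the factor 1/2 - 1.\<close>
  have "((\<lambda>z. 1 / 2 * (pcU a z / pc_lead a z) - pcU (a - 1) z / pc_lead (a - 1) z) \<longlongrightarrow> 1 / 2 * 1 - 1) ?F"
    by (intro tendsto_intros 1)
  moreover have "eventually (\<lambda>z. 1 / 2 * (pcU a z / pc_lead a z) - pcU (a - 1) z / pc_lead (a - 1) z
      = deriv (pcU a) z / (z * pc_lead a z)) ?F"
  proof -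
    have "eventually (\<lambda>z::complex. z \<noteq> 0) ?F"
      by (rule filter_leD[OF inf_le1]) (rule eventually_not_equal_at_infinity)
    thus ?thesis
      by eventually_elim (auto simp: pc_lead_minus_1 deriv_pcU(2) pc_lead_nonzero field_simps)
  qed
  ultimately have "((\<lambda>z. deriv (pcU a) z / (z * pc_lead a z)) \<longlongrightarrow> 1 / 2 * 1 - 1) ?F"
    by (rule Lim_transform_eventually)
  thus "((\<lambda>z. deriv (pcU a) z / (z * pc_lead a z)) \<longlongrightarrow> - 1 / 2) ?F" by simp
qed

lemma filterlim_ray_sector:
  assumes "\<bar>\<phi>\<bar> \<le> pi / 2"
  shows "filterlim (\<lambda>r. of_real r * cis \<phi>) (inf at_infinity (principal (pc_sector (pi / 4)))) at_top"
proof (subst filterlim_inf, intro conjI)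
  show "filterlim (\<lambda>r. of_real r * cis \<phi>) at_infinity at_top"
    unfolding filterlim_at_infinity_conv_norm_at_top by (simp add: norm_mult filterlim_abs_real)
  show "filterlim (\<lambda>r. of_real r * cis \<phi>) (principal (pc_sector (pi / 4))) at_top"
    unfolding filterlim_principal using eventually_gt_at_top[of 0]
  proof eventually_elim
    case (elim r)
    have "\<phi> \<in> {- pi<..pi}"
      using assms pi_gt_zero unfolding greaterThanAtMost_iff abs_le_iff by linarith
    hence "Arg (of_real r * cis \<phi>) = \<phi>" using elim Arg_cis[of \<phi>] by simp
    thus ?case using assms by (simp add: pc_sector_def)
  qed
qed

lemma Ln_ray:
  assumes "r > 0" "\<bar>\<phi>\<bar> < pi" shows "Ln (of_real r * cis \<phi>) = of_real (ln r) + \<i> * \<phi>"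
  using assms exp_of_real[of "ln r", where ?'a = complex]
  by (intro Ln_unique) (auto simp: exp_add cis_conv_exp)

text \<open>Rescaling the variable by \<open>m\<close> multiplies the quadratic coefficient by m^4
  and the parameter by m^2, so fourth roots of unity preserve the form of the equation.\<close>

lemma pc_ode_pcU_rotate:
  assumes "m ^ 4 = 1"
  shows "pc_ode (m\<^sup>2 * a) (\<lambda>z. pcU a (m * z))"
    and "deriv (\<lambda>z. pcU a (m * z)) z = m * deriv (pcU a) (m * z)"
proof -
  have lin: "((\<lambda>z. m * z) has_field_derivative m) (at z)" for z
    by (auto intro!: derivative_eq_intros)
  have d: "((\<lambda>z. pcU a (m * z)) has_field_derivative m * deriv (pcU a) (m * z)) (at z)" for z
    using DERIV_chain2[OF pc_ode_deriv(1)[OF pc_ode_pcU] lin, of a z]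
    by (simp only: mult.commute[of m "deriv (pcU a) (m * z)"])
  have "((\<lambda>z. m * deriv (pcU a) (m * z)) has_field_derivative
      m * ((((m * z)\<^sup>2 / 4 + a) * pcU a (m * z)) * m)) (at z)" for z
    by (rule DERIV_cmult[OF DERIV_chain2[OF pc_ode_deriv(2)[OF pc_ode_pcU] lin]])
  moreover have "m * ((((m * z)\<^sup>2 / 4 + a) * pcU a (m * z)) * m) = (m ^ 4 * z\<^sup>2 / 4 + m\<^sup>2 * a) * pcU a (m * z)" for z
    by (simp add: algebra_simps power2_eq_square power4_eq_xxxx)
  ultimately show "pc_ode (m\<^sup>2 * a) (\<lambda>z. pcU a (m * z))"
    using assms by (intro pc_odeI[OF d]) simp
  show "deriv (\<lambda>z. pcU a (m * z)) z = m * deriv (pcU a) (m * z)" using d by (rule DERIV_imp_deriv)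
qed

text \<open>The sign \<open>e\<close> treats the companions U(-A,-iz) and U(-A,iz) together. The
  Wronskian is constant, so its limit along one well-chosen ray determines it.\<close>

lemma pcU_wronskian:
  assumes e: "e = 1 \<or> e = (- 1 :: real)"
  shows "pcU A z * (- (of_real e * \<i>) * deriv (pcU (- A)) (- (of_real e * \<i>) * z))
       - deriv (pcU A) z * pcU (- A) (- (of_real e * \<i>) * z) = exp (- (of_real e * (A / 2 - 1/4) * pi * \<i>))"
proof -
  define m where "m = - (complex_of_real e * \<i>)"
  have m2: "m\<^sup>2 = -1" and m4: "m * m = -1" using e by (auto simp: m_def power2_eq_square)
  define u where "u = (\<lambda>z. pcU (- A) (m * z))"
  have odeu: "pc_ode A u" and derivu: "deriv u z = m * deriv (pcU (- A)) (m * z)" for z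
    using pc_ode_pcU_rotate[of m "- A"] m2 by (simp_all add: u_def power4_eq_xxxx m4)
  define W where "W = pcU A z * deriv u z - deriv (pcU A) z * u z"
  have W: "pcU A z * deriv u z - deriv (pcU A) z * u z = W" for z
    unfolding W_def by (rule pc_ode_wronskian[OF pc_ode_pcU odeu])
  \<comment> \<open>Multiplication by -ei takes the ray of argument e pi/4 to its conjugate. Both
    rays lie in the sector where the asymptotics hold.\<close>
  define p q where "p = (\<lambda>r. complex_of_real r * cis (e * pi / 4))" and "q = (\<lambda>r. complex_of_real r * cis (- (e * pi / 4)))"
  have phi: "\<bar>e * pi / 4\<bar> \<le> pi / 2" "\<bar>- (e * pi / 4)\<bar> \<le> pi / 2" using e by auto
  have limp: "filterlim p (inf at_infinity (principal (pc_sector (pi / 4)))) at_top"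
    unfolding p_def by (rule filterlim_ray_sector[OF phi(1)])
  have limq: "filterlim q (inf at_infinity (principal (pc_sector (pi / 4)))) at_top"
    unfolding q_def by (rule filterlim_ray_sector[OF phi(2)])
  have mp: "m * p r = q r" for r
  proof -
    have "m = cis (- (e * pi / 2))" using e by (auto simp: m_def)
    hence "m * cis (e * pi / 4) = cis (- (e * pi / 4))" by (simp add: cis_mult mult.commute)
    thus ?thesis by (simp add: p_def q_def mult_ac)
  qed
  define C where "C = exp (- (of_real e * (A / 2 - 1/4) * pi * \<i>))"
  \<comment> \<open>Since q^2 = -p^2 the exponentials cancel, the powers of \<open>r\<close> have
    total exponent 0, and only the constant phase \<open>C\<close> remains.\<close>
  have lead: "p r * pc_lead A (p r) * pc_lead (- A) (q r) = C" if r: "r > 0" for r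
  proof -
    have L: "Ln (p r) = of_real (ln r) + \<i> * (e * pi / 4)" "Ln (q r) = of_real (ln r) - \<i> * (e * pi / 4)"
      using Ln_ray[OF r, of "e * pi / 4"] Ln_ray[OF r, of "- (e * pi / 4)"] e by (auto simp: p_def q_def)
    have nz: "p r \<noteq> 0" "q r \<noteq> 0" using r by (auto simp: p_def q_def)
    have "(q r)\<^sup>2 = - (p r)\<^sup>2" by (simp add: mp[symmetric] m2 power_mult_distrib)
    hence E: "exp (- (p r)\<^sup>2 / 4) * exp (- (q r)\<^sup>2 / 4) = 1" by (simp flip: exp_add)
    have "p r * pc_lead A (p r) * pc_lead (- A) (q r) =
        (exp (Ln (p r)) * (p r) powr (- A - 1/2) * (q r) powr (A - 1/2)) * (exp (- (p r)\<^sup>2 / 4) * exp (- (q r)\<^sup>2 / 4))"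
      using nz by (simp add: pc_lead_def)
    also have "\<dots> = exp (Ln (p r) + (- A - 1/2) * Ln (p r) + (A - 1/2) * Ln (q r))"
      unfolding E using nz by (simp add: powr_def exp_add)
    also have "\<dots> = C" unfolding L C_def by (rule arg_cong[of _ _ exp]) (simp add: field_simps)
    finally show ?thesis .
  qed
  have d: "pi / 4 > 0" by simp
  let ?Q = "\<lambda>r. - (pcU A (p r) / pc_lead A (p r)) * (deriv (pcU (- A)) (q r) / (q r * pc_lead (- A) (q r)))
        - (deriv (pcU A) (p r) / (p r * pc_lead A (p r))) * (pcU (- A) (q r) / pc_lead (- A) (q r))"
  have "(?Q \<longlongrightarrow> - 1 * (- 1 / 2) - (- 1 / 2) * 1) at_top"
    by (intro tendsto_intros filterlim_compose[OF pcU_tendsto(1)[OF d] limp] filterlim_compose[OF pcU_tendsto(1)[OF d] limq]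
        filterlim_compose[OF pcU_tendsto(2)[OF d] limp] filterlim_compose[OF pcU_tendsto(2)[OF d] limq])
  hence "((\<lambda>r. C * ?Q r) \<longlongrightarrow> C * (- 1 * (- 1 / 2) - (- 1 / 2) * 1)) at_top"
    by (rule tendsto_mult_left)
  moreover have "eventually (\<lambda>r. C * ?Q r = W) at_top"
    using eventually_gt_at_top[of 0]
  proof eventually_elim
    case (elim r)
    have nz: "p r \<noteq> 0" "q r \<noteq> 0" using elim by (auto simp: p_def q_def)
    have mq: "m * q r = - p r" unfolding mp[symmetric] mult.assoc[symmetric] m4 by simp
    let ?l = "pc_lead A (p r)" and ?k = "pc_lead (- A) (q r)"
    have l: "?l \<noteq> 0" "?k \<noteq> 0" using nz by (simp_all add: pc_lead_nonzero)
    have "C * ?Q r = p r * ?l * ?k * ?Q r" by (simp only: lead[OF elim])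
    also have "\<dots> = - (p r / q r) * pcU A (p r) * deriv (pcU (- A)) (q r) - deriv (pcU A) (p r) * pcU (- A) (q r)"
      using nz l by (simp add: field_simps)
    also have "- (p r / q r) = m" using mq nz by (simp add: field_simps)
    also have "m * pcU A (p r) * deriv (pcU (- A)) (q r) - deriv (pcU A) (p r) * pcU (- A) (q r) = W"
      unfolding W[of "p r", symmetric] derivu unfolding u_def mp by simp
    finally show ?case .
  qed
  ultimately have "((\<lambda>r::real. W) \<longlongrightarrow> C * (- 1 * (- 1 / 2) - (- 1 / 2) * 1)) at_top"
    by (rule Lim_transform_eventually)
  hence "W = C" by (simp add: tendsto_const_iff)
  thus ?thesis unfolding W_def C_def derivu unfolding u_def m_def .
qed

section \<open>The Laplace transform\<close>

lemma exp_decay_const_nonpos: "k \<le> 0 \<Longrightarrow> exp_decay k (\<lambda>s. c)"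
  by (rule exp_decay_mono[OF exp_decay_const])

text \<open>Lagrange's identity: in the derivative of y u' - y' u the homogeneous terms cancel and
  only -(\<alpha> + \<beta> t) u(t) is left, to be integrated to infinity along the ray.\<close>

lemma inhomogeneous_wronskian:
  assumes u: "pc_ode A u"
    and y: "\<And>z. (y has_field_derivative y' z) (at z)"
    and y': "\<And>z. (y' has_field_derivative (z\<^sup>2 / 4 + A) * y z + (\<alpha> + \<beta> * z)) (at z)"
    and decu: "\<And>k. exp_decay k (\<lambda>s. u (z + of_real s * d))"
    and decu': "\<And>k. exp_decay k (\<lambda>s. deriv u (z + of_real s * d))"
    and decy: "exp_decay (-1) (\<lambda>s. y (z + of_real s * d))"
    and decy': "exp_decay (-1) (\<lambda>s. y' (z + of_real s * d))"
  shows "y z * deriv u z - y' z * u z =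
     - (\<alpha> * int_from_inf d u z + \<beta> * int_from_inf d (\<lambda>t. t * u t) z)"
proof -
  let ?r = "\<lambda>s. z + of_real s * d"
  define G where "G = (\<lambda>t. y t * deriv u t - y' t * u t)"
  define i0 i1 where "i0 = (\<lambda>s. u (?r s) * d)" and "i1 = (\<lambda>s. ?r s * u (?r s) * d)"
  have d0: "exp_decay 1 i0"
    unfolding i0_def using exp_decay_cmult[OF decu, of 1 d] by (simp add: mult.commute)
  have "exp_decay (-1) ?r"
    using exp_decay_add[OF exp_decay_const_nonpos exp_decay_cmult[OF exp_decay_of_real], of "-1" z d]
    by (simp add: mult.commute)
  from exp_decay_cmult[OF exp_decay_mult[OF this decu[of 2]], of d] have d1: "exp_decay 1 i1"
    by (simp add: i1_def mult.commute)
  define g where "g = (\<lambda>s. - (\<alpha> * i0 s + \<beta> * i1 s))"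
  have "exp_decay 1 (\<lambda>s. (-1) * (\<alpha> * i0 s + \<beta> * i1 s))"
    by (intro exp_decay_cmult exp_decay_add d0 d1)
  hence dg: "exp_decay 1 g" by (simp add: g_def)
  \<comment> \<open>Rate 2 for \<open>u\<close> and its derivative outweighs the growth rate allowed
    to \<open>y\<close>, so the boundary term at infinity vanishes.\<close>
  have dG: "exp_decay 1 (\<lambda>s. G (?r s))"
    unfolding G_def
    using exp_decay_diff[OF exp_decay_mult[OF decy decu'[of 2]] exp_decay_mult[OF decy' decu[of 2]]] by simp
  have derG: "(G has_field_derivative - (\<alpha> + \<beta> * t) * u t) (at t)" for t
  proof -
    have "(G has_field_derivative (y t * ((t\<^sup>2 / 4 + A) * u t) + y' t * deriv u t)
        - (y' t * deriv u t + ((t\<^sup>2 / 4 + A) * y t + (\<alpha> + \<beta> * t)) * u t)) (at t)"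
      unfolding G_def by (intro DERIV_diff DERIV_mult' y y' pc_ode_deriv[OF u])
    moreover have "(y t * ((t\<^sup>2 / 4 + A) * u t) + y' t * deriv u t)
        - (y' t * deriv u t + ((t\<^sup>2 / 4 + A) * y t + (\<alpha> + \<beta> * t)) * u t) = - (\<alpha> + \<beta> * t) * u t"
      by (simp add: algebra_simps)
    ultimately show ?thesis by simp
  qed
  have FTC: "integral {0..} g = - G (?r 0)"
  proof (rule integral_Ici_FTC[OF exp_decay_continuous[OF dG] _ exp_decay_absolutely_integrable[OF dg] exp_decay_tendsto_0[OF dG]])
    fix s :: real
    have "((\<lambda>x. z + x * d) has_field_derivative d) (at (of_real s))"
      by (auto intro!: derivative_eq_intros)
    from has_vector_derivative_real_field[OF DERIV_chain2[OF derG this]]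
    show "((\<lambda>s. G (?r s)) has_vector_derivative g s) (at s)"
      by (simp add: g_def i0_def i1_def algebra_simps)
  qed simp_all
  have "integral {0..} g = - (\<alpha> * integral {0..} i0 + \<beta> * integral {0..} i1)"
    unfolding g_def using exp_decay_integrable[OF d0] exp_decay_integrable[OF d1]
    by (simp only: integral_neg integral_add integrable_on_mult_right integral_mult_right zero_less_one)
  with FTC have "- G (?r 0) = - (\<alpha> * integral {0..} i0 + \<beta> * integral {0..} i1)" by (rule trans[OF sym])
  hence "G z = \<alpha> * integral {0..} i0 + \<beta> * integral {0..} i1"
    by (simp only: neg_equal_iff_equal of_real_0 mult_zero_left add_0_right)
  thus ?thesis by (simp add: G_def int_from_inf_def i0_def i1_def)
qed

section \<open>Moments of U against the Laplace kernel and the equation for L_U\<close>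

definition LU_moment :: "complex \<Rightarrow> nat \<Rightarrow> complex \<Rightarrow> complex" where
  "LU_moment a n lam = integral {0..} (\<lambda>t. exp (- (lam * of_real t)) * (of_real t ^ n * pcU a (of_real t)))"

lemma LU_eq_LU_moment: "LU a lam = LU_moment a 0 lam"
  by (simp add: LU_def LU_moment_def)

lemma exp_decay_pcU_moment: "exp_decay k (\<lambda>t. of_real t ^ n * pcU a (of_real t))"
proof (induction n arbitrary: k)
  case 0
  show ?case using exp_decay_pcU(1)[of k a 0] by simp
next
  case (Suc n)
  show ?case using exp_decay_of_real_mult[OF Suc[of "k + 1"], of k] by (simp add: mult.assoc)
qed

lemma exp_decay_LU_moment_integrand: "exp_decay k (\<lambda>t. exp (- (lam * of_real t)) * (of_real t ^ n * pcU a (of_real t)))"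
  using exp_decay_mult[OF exp_decay_exp[of lam] exp_decay_pcU_moment[of "k - Re lam"]] by simp

lemma has_field_derivative_LU_moment: "(LU_moment a n has_field_derivative - LU_moment a (Suc n) lam) (at lam)"
proof -
  have "LU_moment a n = (\<lambda>p. integral {0..} (\<lambda>t. exp (- (p * of_real t)) * (of_real t ^ n * pcU a (of_real t))))"
    by (simp add: fun_eq_iff LU_moment_def)
  moreover have "LU_moment a (Suc n) lam = integral {0..} (\<lambda>t. exp (- (lam * of_real t)) * (of_real t * (of_real t ^ n * pcU a (of_real t))))"
    by (simp add: LU_moment_def mult.assoc)
  ultimately show ?thesis
    using has_field_derivative_laplace[OF exp_decay_pcU_moment[of "1 - Re lam" n a], of lam] by simp
qed

text \<open>The second moment is the second derivative of \<open>LU a\<close>, so this is the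
  inhomogeneous differential equation for the transform; the values of U and U' at 0 are boundary
  terms.\<close>

lemma LU_moment_2: "LU_moment a 2 lam / 4 = (lam\<^sup>2 - a) * LU_moment a 0 lam - deriv (pcU a) 0 - lam * pcU a 0"
proof -
  let ?i = "\<lambda>n t. exp (- (lam * of_real t)) * (of_real t ^ n * pcU a (of_real t))"
  \<comment> \<open>The combination is chosen so that the terms in U' cancel on differentiation,
    leaving exp(-lam x) (U'' - lam^2 U).\<close>
  define F where "F = (\<lambda>x. exp (- (lam * x)) * (deriv (pcU a) x + lam * pcU a x))"
  define f where "f = (\<lambda>t. 1 / 4 * ?i 2 t + (a - lam\<^sup>2) * ?i 0 t)"
  have df: "exp_decay 1 f" unfolding f_def
    by (intro exp_decay_add exp_decay_cmult exp_decay_LU_moment_integrand)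
  have dF: "exp_decay 1 (\<lambda>s. F (of_real s))"
  proof -
    have "exp_decay (1 - Re lam) (\<lambda>s. deriv (pcU a) (of_real s) + lam * pcU a (of_real s))"
      using exp_decay_pcU[of _ a 0] by (intro exp_decay_add exp_decay_cmult) simp_all
    from exp_decay_mult[OF exp_decay_exp[of lam] this] show ?thesis by (simp add: F_def)
  qed
  have "integral {0..} f = - F (of_real 0)"
  proof (rule integral_Ici_FTC[OF exp_decay_continuous[OF dF] _ exp_decay_absolutely_integrable[OF df] exp_decay_tendsto_0[OF dF]])
    fix s :: real
    let ?s = "complex_of_real s"
    have "((\<lambda>x. exp (- (lam * x))) has_field_derivative - lam * exp (- (lam * ?s))) (at ?s)"
      by (auto intro!: derivative_eq_intros)
    hence "(F has_field_derivative exp (- (lam * ?s)) * ((?s\<^sup>2 / 4 + a) * pcU a ?s + lam * deriv (pcU a) ?s)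
        + (- lam * exp (- (lam * ?s))) * (deriv (pcU a) ?s + lam * pcU a ?s)) (at ?s)"
      unfolding F_def by (intro DERIV_mult' DERIV_add DERIV_cmult pc_ode_deriv[OF pc_ode_pcU])
    moreover have "exp (- (lam * ?s)) * ((?s\<^sup>2 / 4 + a) * pcU a ?s + lam * deriv (pcU a) ?s)
        + (- lam * exp (- (lam * ?s))) * (deriv (pcU a) ?s + lam * pcU a ?s) = f s"
      by (simp add: f_def algebra_simps power2_eq_square)
    ultimately have "(F has_field_derivative f s) (at ?s)" by simp
    thus "((\<lambda>s. F (of_real s)) has_vector_derivative f s) (at s)" by (rule has_vector_derivative_real_field)
  qed simp_all
  moreover have "integral {0..} f = 1 / 4 * LU_moment a 2 lam + (a - lam\<^sup>2) * LU_moment a 0 lam"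
    unfolding f_def LU_moment_def
    using exp_decay_integrable[OF exp_decay_LU_moment_integrand[of 1 lam 2 a]] exp_decay_integrable[OF exp_decay_LU_moment_integrand[of 1 lam 0 a]]
    by (simp add: integral_add integrable_on_mult_right)
  ultimately show ?thesis by (simp add: F_def algebra_simps)
qed

text \<open>Boundedness is enough, since the functions paired with these moments decay at every
  rate. It holds because the factor \<open>exp (- (s d t))\<close> has modulus at most 1 when
  \<open>Re d\<close> \<ge> 0, which includes the imaginary directions.\<close>

lemma exp_decay_LU_moment:
  assumes "Re d \<ge> 0" shows "exp_decay 0 (\<lambda>s. LU_moment a n (q + of_real s * d))"
proof -
  obtain C where C: "C > 0" "\<And>t. t \<ge> 0 \<Longrightarrow> norm (exp (- (q * of_real t)) * (of_real t ^ n * pcU a (of_real t))) \<le> C * exp (- (1 * t))"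
    using exp_decayE[OF exp_decay_LU_moment_integrand[of 1 q n a]] by blast
  have int: "(\<lambda>t. C * exp (- (1 * t))) integrable_on {0..}"
    using integrable_on_exp_minus_to_infinity[of 1 0] by (intro integrable_on_mult_right) simp
  show ?thesis
  proof (rule exp_decayI)
    have "continuous_on UNIV (LU_moment a n)"
      using has_field_derivative_LU_moment DERIV_isCont by (blast intro: continuous_at_imp_continuous_on)
    thus "continuous_on {0..} (\<lambda>s. LU_moment a n (q + of_real s * d))"
      by (rule continuous_on_compose2) (auto intro!: continuous_intros)
    fix s :: real assume s: "s \<ge> 0"
    have "norm (LU_moment a n (q + of_real s * d)) \<le> integral {0..} (\<lambda>t. C * exp (- (1 * t)))"
      unfolding LU_moment_def
    proof (rule integral_norm_bound_integral[OF exp_decay_integrable[OF exp_decay_LU_moment_integrand, of 1] int])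
      fix t :: real assume "t \<in> {0..}" hence t: "t \<ge> 0" by simp
      have "norm (exp (- ((q + of_real s * d) * of_real t)) * (of_real t ^ n * pcU a (of_real t)))
         = norm (exp (- (of_real s * d * of_real t))) * norm (exp (- (q * of_real t)) * (of_real t ^ n * pcU a (of_real t)))"
        by (simp add: norm_mult distrib_right flip: exp_add)
      also have "\<dots> \<le> 1 * (C * exp (- (1 * t)))"
        using C t s assms by (intro mult_mono) auto
      finally show "norm (exp (- ((q + of_real s * d) * of_real t)) * (of_real t ^ n * pcU a (of_real t))) \<le> C * exp (- (1 * t))"
        by simp
    qed simp
    thus "norm (LU_moment a n (q + of_real s * d)) \<le> integral {0..} (\<lambda>t. C * exp (- (1 * t))) * exp (- (0 * s))" by simp
  qed
qed

text \<open>The condition \<open>m * d = 1\<close> turns the ray from \<open>z\<close> in direction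
  \<open>d\<close> into a horizontal one for U(b,mz), making that function recessive there;
  \<open>m\<^sup>2 * b = - a\<close> makes it solve the homogeneous equation of y(z) =
  \<open>LU a (z / 2)\<close>.\<close>

lemma LU_moment_wronskian:
  assumes m: "m ^ 4 = 1" "m * d = 1" "Re d \<ge> 0" and b: "m\<^sup>2 * b = - a"
  shows "LU a (z / 2) * (m * deriv (pcU b) (m * z)) + LU_moment a 1 (z / 2) / 2 * pcU b (m * z) =
     deriv (pcU a) 0 * int_from_inf d (\<lambda>t. t ^ 0 * pcU b (m * t)) z
     + 1 / 2 * pcU a 0 * int_from_inf d (\<lambda>t. t ^ 1 * pcU b (m * t)) z"
proof -
  define u where "u = (\<lambda>z. pcU b (m * z))"
  have u: "pc_ode (- a) u" and du: "deriv u z = m * deriv (pcU b) (m * z)" for z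
    using pc_ode_pcU_rotate[OF m(1), of b] b by (simp_all add: u_def)
  have ray: "m * (z + of_real s * d) = m * z + of_real s" for s
    using m(2) by (simp add: distrib_left mult.left_commute)
  have half: "((\<lambda>z. z / 2) has_field_derivative 1 / 2) (at z)" for z :: complex
    by (auto intro!: derivative_eq_intros)
  have y: "((\<lambda>z. LU_moment a 0 (z / 2)) has_field_derivative - (LU_moment a 1 (z / 2) / 2)) (at z)" for z
    using DERIV_chain2[OF has_field_derivative_LU_moment half, of a 0 z] by simp
  have "((\<lambda>z. LU_moment a 1 (z / 2) / 2) has_field_derivative (- LU_moment a 2 (z / 2) * (1 / 2)) / 2) (at z)" for z
    using DERIV_cdivide[OF DERIV_chain2[OF has_field_derivative_LU_moment half, of a 1 z], of 2] by (simp add: numeral_2_eq_2)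
  hence D: "((\<lambda>z. - (LU_moment a 1 (z / 2) / 2)) has_field_derivative - ((- LU_moment a 2 (z / 2) * (1 / 2)) / 2)) (at z)" for z
    by (rule DERIV_minus)
  \<comment> \<open>\<open>LU_moment_2\<close> at z/2; the forcing coefficients read off here are
    \<alpha> = -U'(a,0) and \<beta> = -U(a,0)/2.\<close>
  have E: "- ((- LU_moment a 2 (z / 2) * (1 / 2)) / 2) =
      (z\<^sup>2 / 4 + - a) * LU_moment a 0 (z / 2) + (- deriv (pcU a) 0 + (- pcU a 0 / 2) * z)" for z
    using LU_moment_2[of a "z / 2"] by (simp add: power_divide algebra_simps)
  have y': "((\<lambda>z. - (LU_moment a 1 (z / 2) / 2)) has_field_derivative
      (z\<^sup>2 / 4 + - a) * LU_moment a 0 (z / 2) + (- deriv (pcU a) 0 + (- pcU a 0 / 2) * z)) (at z)" for z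
    using D[of z] unfolding E .
  have dec: "exp_decay (-1) (\<lambda>s. LU_moment a n ((z + of_real s * d) / 2))" for n
  proof -
    have "exp_decay (-1) (\<lambda>s. LU_moment a n (z / 2 + of_real s * (d / 2)))"
      by (rule exp_decay_mono[OF exp_decay_LU_moment]) (use m in auto)
    thus ?thesis by (simp add: add_divide_distrib)
  qed
  have "LU_moment a 0 (z / 2) * deriv u z - - (LU_moment a 1 (z / 2) / 2) * u z =
     - (- deriv (pcU a) 0 * int_from_inf d u z + - pcU a 0 / 2 * int_from_inf d (\<lambda>t. t * u t) z)"
  proof (rule inhomogeneous_wronskian[OF u y y'])
    show "exp_decay k (\<lambda>s. u (z + of_real s * d))" for k
      unfolding u_def ray by (rule exp_decay_pcU)
    show "exp_decay k (\<lambda>s. deriv u (z + of_real s * d))" for k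
      unfolding du ray by (intro exp_decay_cmult exp_decay_pcU)
    show "exp_decay (-1) (\<lambda>s. LU_moment a 0 ((z + of_real s * d) / 2))" by (rule dec)
    show "exp_decay (-1) (\<lambda>s. - (LU_moment a 1 ((z + of_real s * d) / 2) / 2))"
      using exp_decay_cmult[OF dec, of "- 1 / 2" 1] by simp
  qed
  thus ?thesis unfolding du by (simp add: u_def LU_eq_LU_moment)
qed

text \<open>Cramer's rule for the unknowns \<open>y\<close> and \<open>y'\<close>. The factor
  \<open>E\<close> is the inverse determinant, which in each case is the normalizing factor of the
  corresponding inhomogeneous solution.\<close>

lemma two_ray_formula:
  fixes y y' :: complex
  assumes W: "v1 * v2' - v1' * v2 = W" and E: "E * W = 1"
    and P1: "y * v1' + y' * v1 = p * I01 + 1 / 2 * q * I11"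
    and P2: "y * v2' + y' * v2 = p * I02 + 1 / 2 * q * I12"
  shows "y = - p * (E * (v2 * I01 - v1 * I02)) - 1 / 2 * q * (E * (v2 * I11 - v1 * I12))"
proof -
  have "y * W = v1 * (y * v2' + y' * v2) - v2 * (y * v1' + y' * v1)"
    unfolding W[symmetric] by (simp add: algebra_simps)
  hence "E * W * y = E * (v1 * (p * I02 + 1 / 2 * q * I12) - v2 * (p * I01 + 1 / 2 * q * I11))"
    unfolding P1 P2 by (simp add: mult_ac)
  thus ?thesis unfolding E by (simp add: algebra_simps)
qed

theorem theorem5p2:
  fixes a lam :: complex
  shows "LU a lam = - deriv (pcU a) 0 * U01 0 (-a) (2 * lam) - 1/2 * pcU a 0 * U01 1 (-a) (2 * lam)
     \<and> LU a lam = - deriv (pcU a) 0 * U03 0 (-a) (2 * lam) - 1/2 * pcU a 0 * U03 1 (-a) (2 * lam)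
     \<and> (a + 1/2 \<notin> \<int>\<^sub>\<le>\<^sub>0 \<longrightarrow>
        LU a lam = - deriv (pcU a) 0 * U13 0 (-a) (2 * lam) - 1/2 * pcU a 0 * U13 1 (-a) (2 * lam))"
proof (intro conjI impI)
  define z where "z = 2 * lam"
  have z: "lam = z / 2" by (simp add: z_def)
  note ray = LU_moment_wronskian[where z = z and a = a]
  \<comment> \<open>The relations \<open>R\<close>, \<open>P\<close> and \<open>M\<close> belong to
    the directions 1, i and -i; each pair of directions gives one of the three formulas.\<close>
  have R: "LU a (z / 2) * deriv (pcU (- a)) z + LU_moment a 1 (z / 2) / 2 * pcU (- a) z =
     deriv (pcU a) 0 * int_from_inf 1 (\<lambda>t. t ^ 0 * pcU (- a) t) z
     + 1 / 2 * pcU a 0 * int_from_inf 1 (\<lambda>t. t ^ 1 * pcU (- a) t) z"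
    using ray[of 1 1 "- a"] by simp
  have P: "LU a (z / 2) * (- \<i> * deriv (pcU a) (- \<i> * z)) + LU_moment a 1 (z / 2) / 2 * pcU a (- \<i> * z) =
     deriv (pcU a) 0 * int_from_inf \<i> (\<lambda>t. t ^ 0 * pcU a (- \<i> * t)) z
     + 1 / 2 * pcU a 0 * int_from_inf \<i> (\<lambda>t. t ^ 1 * pcU a (- \<i> * t)) z"
    by (rule ray) (simp_all add: power2_eq_square power4_eq_xxxx)
  have M: "LU a (z / 2) * (\<i> * deriv (pcU a) (\<i> * z)) + LU_moment a 1 (z / 2) / 2 * pcU a (\<i> * z) =
     deriv (pcU a) 0 * int_from_inf (- \<i>) (\<lambda>t. t ^ 0 * pcU a (\<i> * t)) z
     + 1 / 2 * pcU a 0 * int_from_inf (- \<i>) (\<lambda>t. t ^ 1 * pcU a (\<i> * t)) z"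
    by (rule ray) (simp_all add: power2_eq_square power4_eq_xxxx)
  have W1: "pcU (- a) z * (- \<i> * deriv (pcU a) (- \<i> * z)) - deriv (pcU (- a)) z * pcU a (- \<i> * z)
      = exp (- (((- a) / 2 - 1/4) * pi * \<i>))"
    using pcU_wronskian[of 1 "- a" z] by simp
  have W3: "pcU (- a) z * (\<i> * deriv (pcU a) (\<i> * z)) - deriv (pcU (- a)) z * pcU a (\<i> * z)
      = exp (((- a) / 2 - 1/4) * pi * \<i>)"
  proof -
    have "exp (- (of_real (- 1) * ((- a) / 2 - 1/4) * pi * \<i>)) = exp (((- a) / 2 - 1/4) * pi * \<i>)"
      by (rule arg_cong[of _ _ exp]) (simp add: algebra_simps)
    thus ?thesis using pcU_wronskian[of "-1" "- a" z] by simp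
  qed
  show "LU a lam = - deriv (pcU a) 0 * U01 0 (-a) (2 * lam) - 1/2 * pcU a 0 * U01 1 (-a) (2 * lam)"
    unfolding z_def[symmetric] unfolding z U01_def minus_minus
    by (rule two_ray_formula[OF W1 _ R P]) (simp flip: exp_add)
  show "LU a lam = - deriv (pcU a) 0 * U03 0 (-a) (2 * lam) - 1/2 * pcU a 0 * U03 1 (-a) (2 * lam)"
    unfolding z_def[symmetric] unfolding z U03_def minus_minus
    by (rule two_ray_formula[OF W3 _ R M]) (simp add: algebra_simps flip: exp_add)
  assume a: "a + 1/2 \<notin> \<int>\<^sub>\<le>\<^sub>0"
  \<comment> \<open>At its poles \<open>Gamma\<close> has the value 0 by convention, so the
    hypothesis is what makes the prefactor of \<open>U13\<close> the inverse of a Wronskian.\<close>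
  have G: "Gamma (a + 1/2) \<noteq> 0" using a by (simp add: Gamma_eq_zero_iff)
  \<comment> \<open>The constant Wronskian of U(a,-iz) and U(a,iz) is evaluated at 0, where it
    reduces to the product known from \<open>pcU_0_product\<close>.\<close>
  have "pcU a (- \<i> * z) * (\<i> * deriv (pcU a) (\<i> * z)) - (- \<i> * deriv (pcU a) (- \<i> * z)) * pcU a (\<i> * z)
      = - \<i> * (- 2 * pcU a 0 * deriv (pcU a) 0)"
  proof -
    have o: "pc_ode (- a) (\<lambda>z. pcU a (- \<i> * z))" "pc_ode (- a) (\<lambda>z. pcU a (\<i> * z))"
      and d: "deriv (\<lambda>z. pcU a (- \<i> * z)) x = - \<i> * deriv (pcU a) (- \<i> * x)"
        "deriv (\<lambda>z. pcU a (\<i> * z)) x = \<i> * deriv (pcU a) (\<i> * x)" for x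
      using pc_ode_pcU_rotate[of "- \<i>" a] pc_ode_pcU_rotate[of "\<i>" a] by (simp_all add: power4_eq_xxxx)
    from pc_ode_wronskian[OF o, of z 0] show ?thesis unfolding d by simp
  qed
  hence W: "pcU a (- \<i> * z) * (\<i> * deriv (pcU a) (\<i> * z)) - (- \<i> * deriv (pcU a) (- \<i> * z)) * pcU a (\<i> * z)
      = - \<i> * (of_real (sqrt (2 * pi)) * rGamma (a + 1/2))"
    unfolding pcU_0_product .
  have "\<i> * Gamma (1/2 + a) / of_real (sqrt (2 * pi)) * (- \<i> * (of_real (sqrt (2 * pi)) * rGamma (a + 1/2))) = 1"
    using G by (simp add: rGamma_inverse_Gamma add.commute field_simps)
  from two_ray_formula[OF W this P M]
  show "LU a lam = - deriv (pcU a) 0 * U13 0 (-a) (2 * lam) - 1/2 * pcU a 0 * U13 1 (-a) (2 * lam)"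
    unfolding z_def[symmetric] unfolding z U13_def by simp
qed

end
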